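(* Let $3\le p<\infty$ and $k=2$. For $\frac12<s\le\frac58$ let $K_s=K(1,1,s,s)$, i.e. the convex quadrilateral with vertices $(0,0),(1,0),(s,s),(0,1)$, let $h_s$ be its diameter, and let $u(x,y)=x(x-1/4)(x-3/4)(x-3/8)(x-1)$. Every $K_s$ satisfies $mac(\pi/4)$, and the maximum angle of $K_s$ approaches $\pi$ as $s\to\frac12$. Moreover, there is no constant $C$ independent of $s$ such that $$|u-Q_2u|_{1,p,K_s}\le C\,h_s^2\,|u|_{3,p,K_s}\qquad\text{for all } \tfrac12<s\le\tfrac58 .$$
   Context: $|u|_{m,p,K}$ is the seminorm of $W^{m,p}(K)$ involving only the derivatives of order exactly $m$. A convex quadrilateral $K$ satisfies $mac(\psi_m)$ if every internal angle $\theta$ of $K$ satisfies $0<\psi_m\le\theta$. Interpolation. Let $\widehat K=[0,1]^2$ with vertices $\widehat V_1=(0,0),\widehat V_2=(1,0),\widehat V_3=(1,1),\widehat V_4=(0,1)$. For a convex quadrilateral $K$ with vertices $V_1,\dots,V_4$ in counterclockwise order, let $F_K:\widehat K\to K$, $F_K(\hat x)=\sum_{i=1}^4 V_i\widehat\phi_i(\hat x)$, where $\widehat\phi_i$ is the bilinear function with $\widehat\phi_i(\widehat V_j)=\delta_{ij}$. Let $\widehat Q_k$ be the Lagrange interpolation operator on $\widehat K$ at the points $(j/k,i/k)$, $0\le i,j\le k$, onto the space $\mathcal{Q}_k$ of polynomials of degree at most $k$ in each variable. Then $Q_ku(X)=\widehat Q_k(u\circ F_K)(F_K^{-1}(X))$.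 *)

theory Defs
  imports "HOL-Analysis.Analysis"
begin

section \<open>Sobolev seminorms on planar sets\<close>

definition pdx :: "(real \<times> real \<Rightarrow> real) \<Rightarrow> real \<times> real \<Rightarrow> real" where
  "pdx f = (\<lambda>(x, y). deriv (\<lambda>t. f (t, y)) x)"

definition pdy :: "(real \<times> real \<Rightarrow> real) \<Rightarrow> real \<times> real \<Rightarrow> real" where
  "pdy f = (\<lambda>(x, y). deriv (\<lambda>t. f (x, t)) y)"

definition pderivs :: "nat \<times> nat \<Rightarrow> (real \<times> real \<Rightarrow> real) \<Rightarrow> real \<times> real \<Rightarrow> real" where
  "pderivs \<alpha> f = (pdx ^^ fst \<alpha>) ((pdy ^^ snd \<alpha>) f)"

fun C_n :: "nat \<Rightarrow> (real \<times> real \<Rightarrow> real) \<Rightarrow> bool" where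
  "C_n 0 f \<longleftrightarrow> continuous_on UNIV f"
| "C_n (Suc n) f \<longleftrightarrow> (\<forall>z. f differentiable (at z)) \<and> C_n n (pdx f) \<and> C_n n (pdy f)"

definition test_functions :: "(real \<times> real) set \<Rightarrow> (real \<times> real \<Rightarrow> real) set" where
  "test_functions \<Omega> = {\<phi>. (\<forall>n. C_n n \<phi>) \<and>
     compact (closure {z. \<phi> z \<noteq> 0}) \<and> closure {z. \<phi> z \<noteq> 0} \<subseteq> \<Omega>}"

definition locally_integrable :: "(real \<times> real) set \<Rightarrow> (real \<times> real \<Rightarrow> real) \<Rightarrow> bool" where
  "locally_integrable \<Omega> f \<longleftrightarrow> (\<forall>C. compact C \<and> C \<subseteq> \<Omega> \<longrightarrow> set_integrable lebesgue C f)"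

definition is_weak_deriv ::
  "nat \<times> nat \<Rightarrow> (real \<times> real) set \<Rightarrow> (real \<times> real \<Rightarrow> real) \<Rightarrow> (real \<times> real \<Rightarrow> real) \<Rightarrow> bool" where
  "is_weak_deriv \<alpha> \<Omega> u v \<longleftrightarrow> locally_integrable \<Omega> u \<and> locally_integrable \<Omega> v \<and>
     (\<forall>\<phi> \<in> test_functions \<Omega>.
        (LINT z:\<Omega>|lebesgue. u z * pderivs \<alpha> \<phi> z)
          = (- 1) ^ (fst \<alpha> + snd \<alpha>) * (LINT z:\<Omega>|lebesgue. v z * \<phi> z))"

text \<open>Weak derivatives are unique up to null sets, so the choice does not influence integrals.\<close>

definition weak_deriv ::
  "nat \<times> nat \<Rightarrow> (real \<times> real) set \<Rightarrow> (real \<times> real \<Rightarrow> real) \<Rightarrow> real \<times> real \<Rightarrow> real" where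
  "weak_deriv \<alpha> \<Omega> u = (SOME v. is_weak_deriv \<alpha> \<Omega> u v)"

text \<open>The value is meaningful for functions in the Sobolev space \<open>W\<^sup>m\<^sup>,\<^sup>p\<close> of the interior of \<open>K\<close> only.
  It is unspecified if a weak derivative does not exist, and a weak derivative outside
  \<open>L\<^sup>p\<close> contributes 0.\<close>

definition sobolev_seminorm ::
  "nat \<Rightarrow> real \<Rightarrow> (real \<times> real) set \<Rightarrow> (real \<times> real \<Rightarrow> real) \<Rightarrow> real" where
  "sobolev_seminorm m p K u =
     (\<Sum>i\<le>m. LINT z:interior K|lebesgue. \<bar>weak_deriv (i, m - i) (interior K) u z\<bar> powr p) powr (1 / p)"


section \<open>Convex quadrilaterals\<close>

text \<open>A quadrilateral is given by its vertices \<open>V 1, V 2, V 3, V 4\<close>; other indices are ignored.\<close>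

definition next_vertex :: "nat \<Rightarrow> nat" where
  "next_vertex i = (if i = 4 then 1 else i + 1)"

definition prev_vertex :: "nat \<Rightarrow> nat" where
  "prev_vertex i = (if i = 1 then 4 else i - 1)"

definition cross2 :: "real \<times> real \<Rightarrow> real \<times> real \<Rightarrow> real" where
  "cross2 a b = fst a * snd b - snd a * fst b"

text \<open>A strict left turn at each of the four vertices: for four points this says exactly that they
  are the vertices of a nondegenerate convex quadrilateral in counterclockwise order.\<close>

definition convex_quadrilateral :: "(nat \<Rightarrow> real \<times> real) \<Rightarrow> bool" where
  "convex_quadrilateral V \<longleftrightarrow>
     (\<forall>i\<in>{1..4}. cross2 (V i - V (prev_vertex i)) (V (next_vertex i) - V i) > 0)"

definition quad :: "(nat \<Rightarrow> real \<times> real) \<Rightarrow> (real \<times> real) set" where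
  "quad V = convex hull (V ` {1..4})"

text \<open>Internal angles of a convex quadrilateral are less than \<open>pi\<close>, so they are the unsigned angles
  between adjacent sides.\<close>

definition internal_angle :: "(nat \<Rightarrow> real \<times> real) \<Rightarrow> nat \<Rightarrow> real" where
  "internal_angle V i =
     (let a = V (next_vertex i) - V i; b = V (prev_vertex i) - V i
      in arccos ((a \<bullet> b) / (norm a * norm b)))"

definition max_angle :: "(nat \<Rightarrow> real \<times> real) \<Rightarrow> real" where
  "max_angle V = Max (internal_angle V ` {1..4})"

definition mac :: "real \<Rightarrow> (nat \<Rightarrow> real \<times> real) \<Rightarrow> bool" where
  "mac \<psi> V \<longleftrightarrow> convex_quadrilateral V \<and> (\<forall>i\<in>{1..4}. 0 < \<psi> \<and> \<psi> \<le> internal_angle V i)"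

text \<open>The vertices of \<open>K(a, b, a', b')\<close>.\<close>

definition K_vertices :: "real \<Rightarrow> real \<Rightarrow> real \<Rightarrow> real \<Rightarrow> nat \<Rightarrow> real \<times> real" where
  "K_vertices a b a' b' i =
     (if i = 1 then (0, 0) else if i = 2 then (a, 0) else if i = 3 then (a', b') else (0, b))"


section \<open>Isoparametric Lagrange interpolation\<close>

definition ref_square :: "(real \<times> real) set" where
  "ref_square = {0..1} \<times> {0..1}"

abbreviation ref_vertices :: "nat \<Rightarrow> real \<times> real" where
  "ref_vertices \<equiv> K_vertices 1 1 1 1"

text \<open>Polynomials of degree at most \<open>k\<close> in each variable, as functions on the whole plane.\<close>

definition poly_Q :: "nat \<Rightarrow> (real \<times> real \<Rightarrow> real) set" where
  "poly_Q k = {q. \<exists>c. \<forall>x y. q (x, y) = (\<Sum>i\<le>k. \<Sum>j\<le>k. c i j * x ^ i * y ^ j)}"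

definition ref_basis :: "nat \<Rightarrow> real \<times> real \<Rightarrow> real" where
  "ref_basis i = (\<lambda>(x, y).
     if i = 1 then (1 - x) * (1 - y) else if i = 2 then x * (1 - y)
     else if i = 3 then x * y else (1 - x) * y)"

lemma ref_basis_characterization:
  assumes "i \<in> {1..4}"
  shows "(q \<in> poly_Q 1 \<and> (\<forall>j\<in>{1..4}. q (ref_vertices j) = (if j = i then 1 else 0)))
           \<longleftrightarrow> q = ref_basis i"
proof -
  have I: "{1..4::nat} = {1, 2, 3, 4}" by auto
  have ball: "(\<forall>j\<in>{1..4::nat}. P j) \<longleftrightarrow> P 1 \<and> P 2 \<and> P 3 \<and> P 4" for P
    unfolding I by blast
  have i: "i = 1 \<or> i = 2 \<or> i = 3 \<or> i = 4" using assms unfolding atLeastAtMost_iff by presburger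
  have Q: "q \<in> poly_Q 1 \<longleftrightarrow> (\<exists>a b c d. \<forall>x y. q (x, y) = a + b * x + c * y + d * x * y)" for q
  proof
    assume "q \<in> poly_Q 1"
    then obtain c where "\<forall>x y. q (x, y) = (\<Sum>i\<le>1. \<Sum>j\<le>1. c i j * x ^ i * y ^ j)"
      unfolding poly_Q_def by blast
    then have "\<forall>x y. q (x, y) = c 0 0 + c 1 0 * x + c 0 1 * y + c 1 1 * x * y"
      by simp
    then show "\<exists>a b c d. \<forall>x y. q (x, y) = a + b * x + c * y + d * x * y" by blast
  next
    assume "\<exists>a b c d. \<forall>x y. q (x, y) = a + b * x + c * y + d * x * y"
    then obtain a b c d where q: "\<forall>x y. q (x, y) = a + b * x + c * y + d * x * y" by blast
    define e where "e i j = (if i = (0::nat) then (if j = (0::nat) then a else c)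
                             else (if j = 0 then b else d))" for i j
    have "\<forall>x y. q (x, y) = (\<Sum>i\<le>1. \<Sum>j\<le>1. e i j * x ^ i * y ^ j)"
      using q by (simp add: e_def)
    then show "q \<in> poly_Q 1" unfolding poly_Q_def by blast
  qed
  show ?thesis
  proof
    assume L: "q \<in> poly_Q 1 \<and> (\<forall>j\<in>{1..4}. q (ref_vertices j) = (if j = i then 1 else 0))"
    then obtain a b c d where q: "\<forall>x y. q (x, y) = a + b * x + c * y + d * x * y"
      using Q by blast
    have v: "q (0, 0) = (if 1 = i then 1 else 0)" "q (1, 0) = (if 2 = i then 1 else 0)"
      "q (1, 1) = (if 3 = i then 1 else 0)" "q (0, 1) = (if 4 = i then 1 else 0)"
      using L unfolding ball by (simp_all add: K_vertices_def)
    have w: "a = (if i = 1 then 1 else 0)" "b = (if i = 2 then 1 else 0) - a"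
      "c = (if i = 4 then 1 else 0) - a" "d = (if i = 3 then 1 else 0) - a - b - c"
      using v q by simp_all
    have "q (x, y) = ref_basis i (x, y)" for x y
      unfolding q[rule_format] using i
      by (elim disjE) (simp_all add: w ref_basis_def algebra_simps)
    then show "q = ref_basis i" by auto
  next
    assume R: "q = ref_basis i"
    have "\<exists>a b c d. \<forall>x y. ref_basis i (x, y) = a + b * x + c * y + d * x * y"
      using i
    proof (elim disjE)
      assume "i = 1"
      then have "\<forall>x y. ref_basis i (x, y) = 1 + (- 1) * x + (- 1) * y + 1 * x * y"
        by (simp add: ref_basis_def algebra_simps)
      then show ?thesis by blast
    next
      assume "i = 2"
      then have "\<forall>x y. ref_basis i (x, y) = 0 + 1 * x + 0 * y + (- 1) * x * y"
        by (simp add: ref_basis_def algebra_simps)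
      then show ?thesis by blast
    next
      assume "i = 3"
      then have "\<forall>x y. ref_basis i (x, y) = 0 + 0 * x + 0 * y + 1 * x * y"
        by (simp add: ref_basis_def algebra_simps)
      then show ?thesis by blast
    next
      assume "i = 4"
      then have "\<forall>x y. ref_basis i (x, y) = 0 + 0 * x + 1 * y + (- 1) * x * y"
        by (simp add: ref_basis_def algebra_simps)
      then show ?thesis by blast
    qed
    then show "q \<in> poly_Q 1 \<and> (\<forall>j\<in>{1..4}. q (ref_vertices j) = (if j = i then 1 else 0))"
      using i unfolding R Q ball by (elim disjE) (simp_all add: K_vertices_def ref_basis_def)
  qed
qed

definition F_map :: "(nat \<Rightarrow> real \<times> real) \<Rightarrow> real \<times> real \<Rightarrow> real \<times> real" where
  "F_map V z = (\<Sum>i=1..4. ref_basis i z *\<^sub>R V i)"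

definition lagrange_interp :: "nat \<Rightarrow> (real \<times> real \<Rightarrow> real) \<Rightarrow> real \<times> real \<Rightarrow> real" where
  "lagrange_interp k f =
     (THE q. q \<in> poly_Q k \<and>
        (\<forall>i\<le>k. \<forall>j\<le>k. q (real j / real k, real i / real k) = f (real j / real k, real i / real k)))"

definition Q_interp ::
  "nat \<Rightarrow> (nat \<Rightarrow> real \<times> real) \<Rightarrow> (real \<times> real \<Rightarrow> real) \<Rightarrow> real \<times> real \<Rightarrow> real" where
  "Q_interp k V u X = lagrange_interp k (u \<circ> F_map V) (inv_into ref_square (F_map V) X)"

end

theory Submission
  imports Defs
begin

text \<open>
Write \<open>t = 1 - s\<close>. The bilinear map onto \<open>K\<^sub>s\<close> has Jacobian determinant \<open>J = 1 - t (x + y)\<close>, which at the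
corner \<open>(1, 1)\<close> equals \<open>2 s - 1\<close> and so degenerates as \<open>s\<close> tends to 1/2. The function \<open>u\<close> depends on \<open>X\<close>
only, so the \<open>Y\<close> derivative of the interpolation error is, up to sign, that of the interpolant, namely
\<open>N / J\<close> with \<open>N = t x q\<^sub>x + (1 - t y) q\<^sub>y\<close> for the biquadratic \<open>q\<close> on the reference square. The roots of \<open>u\<close> are
chosen such that \<open>N\<close> does not vanish at \<open>(1, 1)\<close> for \<open>t = 1/2\<close> (\<open>dY_numer_u_poly\<close>); by continuity it is
bounded away from 0 near this corner, uniformly in \<open>s\<close>. Near the flat vertex the sublevel set where \<open>J \<le> r\<close> has
area of order \<open>r ^ 3\<close> when \<open>r \<ge> 2 (2 s - 1)\<close>, so the integral of \<open>J\<close> to the power \<open>- p\<close> grows at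
least like \<open>ln (1 / (2 s - 1))\<close> for \<open>p \<ge> 3\<close> (\<open>error_integral_ge\<close>).
The right-hand side of the estimate stays bounded, because all elements lie in the unit square and the third derivative of \<open>u\<close> is a fixed polynomial
(\<open>sobolev_seminorm_poly_fst_le\<close>).

The seminorms are defined through a choice of weak derivatives. To compute them, continuous classical
derivatives are shown to be weak derivatives (by integration by parts), and weak derivatives are shown to
be unique almost everywhere (by the fundamental lemma of the calculus of variations); together this gives
\<open>weak_deriv_Lp_integral\<close>. The logarithmic integral is computed directly on the element, over
an explicit region, with the inverse of the bilinear map in closed form.
\<close>

section \<open>Smooth functions of two variables\<close>

lemma has_derivative_slice_x:
  assumes "f differentiable (at (x, y))"
  shows "((\<lambda>t. f (t, y)) has_real_derivative pdx f (x, y)) (at x)"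
proof -
  have "(\<lambda>t. f (t, y)) differentiable (at x)"
    by (rule differentiable_compose[where f = f and g = "\<lambda>t. (t, y)"])
      (auto intro: assms differentiable_Pair)
  then show ?thesis
    unfolding pdx_def by (simp add: DERIV_deriv_iff_real_differentiable)
qed

lemma has_derivative_slice_y:
  assumes "f differentiable (at (x, y))"
  shows "((\<lambda>t. f (x, t)) has_real_derivative pdy f (x, y)) (at y)"
proof -
  have "(\<lambda>t. f (x, t)) differentiable (at y)"
    by (rule differentiable_compose[where f = f and g = "\<lambda>t. (x, t)"])
      (auto intro: assms differentiable_Pair)
  then show ?thesis
    unfolding pdy_def by (simp add: DERIV_deriv_iff_real_differentiable)
qed

lemma pdx_eqI:
  assumes "\<And>x y. ((\<lambda>t. f (t, y)) has_real_derivative g (x, y)) (at x)"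
  shows "pdx f = g"
  using assms by (auto simp: pdx_def fun_eq_iff intro!: DERIV_imp_deriv)

lemma pdy_eqI:
  assumes "\<And>x y. ((\<lambda>t. f (x, t)) has_real_derivative g (x, y)) (at y)"
  shows "pdy f = g"
  using assms by (auto simp: pdy_def fun_eq_iff intro!: DERIV_imp_deriv)

text \<open>The predicate \<^term>\<open>C_n\<close> recurses on partial derivatives, so each closure
property is an induction in which \<^const>\<open>pdx\<close> and \<^const>\<open>pdy\<close> of the compound function must first be
computed as functions on the whole plane.\<close>

lemma C_n_SucD: "C_n (Suc n) f \<Longrightarrow> C_n n f"
proof (induction n arbitrary: f)
  case 0
  then show ?case
    by (auto intro!: continuous_at_imp_continuous_on differentiable_imp_continuous_within)
next
  case (Suc n)
  then show ?case by (metis C_n.simps(2))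
qed

lemma C_n_add:
  "C_n n f \<Longrightarrow> C_n n g \<Longrightarrow> C_n n (\<lambda>z. f z + g z)"
proof (induction n arbitrary: f g)
  case 0
  then show ?case by (auto intro: continuous_on_add)
next
  case (Suc n)
  have "pdx (\<lambda>z. f z + g z) = (\<lambda>z. pdx f z + pdx g z)"
    "pdy (\<lambda>z. f z + g z) = (\<lambda>z. pdy f z + pdy g z)"
    using Suc.prems
    by (auto intro!: pdx_eqI pdy_eqI derivative_eq_intros
        has_derivative_slice_x has_derivative_slice_y)
  then show ?case using Suc by (auto intro: differentiable_add)
qed

lemma C_n_mult:
  "C_n n f \<Longrightarrow> C_n n g \<Longrightarrow> C_n n (\<lambda>z. f z * g z)"
proof (induction n arbitrary: f g)
  case 0
  then show ?case by (auto intro: continuous_on_mult)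
next
  case (Suc n)
  have x: "pdx (\<lambda>z. f z * g z) = (\<lambda>z. pdx f z * g z + f z * pdx g z)"
    using Suc.prems
    by (intro pdx_eqI) (auto intro!: derivative_eq_intros has_derivative_slice_x)
  have y: "pdy (\<lambda>z. f z * g z) = (\<lambda>z. pdy f z * g z + f z * pdy g z)"
    using Suc.prems
    by (intro pdy_eqI) (auto intro!: derivative_eq_intros has_derivative_slice_y)
  have "C_n n f" "C_n n g" using Suc.prems by (auto dest!: C_n_SucD simp del: C_n.simps)
  then show ?case unfolding C_n.simps x y using Suc
    by (auto intro!: differentiable_mult C_n_add)
qed

text \<open>The classical flat function \<open>exp (- 1 / t)\<close>, extended by 0. The polynomial factor in \<open>1 / t\<close>
makes the family closed under differentiation, so that smoothness is a single induction over all
members at once.\<close>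

definition flat :: "real poly \<Rightarrow> real \<Rightarrow> real" where
  "flat P t = (if t > 0 then poly P (1 / t) * exp (- (1 / t)) else 0)"

lemma tendsto_poly_times_exp_minus: "((\<lambda>x::real. poly P x * exp (- x)) \<longlongrightarrow> 0) at_top"
proof -
  have "((\<lambda>x. \<Sum>i\<le>degree P. coeff P i * (x ^ i / exp x)) \<longlongrightarrow> (\<Sum>i\<le>degree P. coeff P i * 0)) at_top"
    by (intro tendsto_intros tendsto_power_div_exp_0)
  then show ?thesis
    by (simp add: poly_altdef sum_divide_distrib exp_minus divide_inverse[symmetric])
qed

lemma flat_tendsto_0: "(flat P \<longlongrightarrow> 0) (at 0)"
proof -
  have "((\<lambda>t::real. poly P (inverse t) * exp (- inverse t)) \<longlongrightarrow> 0) (at_right 0)"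
    by (rule filterlim_compose[OF tendsto_poly_times_exp_minus filterlim_inverse_at_top_right])
  then have r: "(flat P \<longlongrightarrow> 0) (at_right 0)"
    by (rule Lim_transform_eventually)
      (auto simp: flat_def eventually_at_filter field_simps)
  have l: "(flat P \<longlongrightarrow> 0) (at_left 0)"
    by (rule tendsto_eventually) (auto simp: flat_def eventually_at_filter)
  show ?thesis using l r by (simp add: filterlim_split_at)
qed

text \<open>Away from 0 this is calculus. At 0 the difference quotient of \<open>flat P\<close> is again a member of
the family, with \<open>P\<close> multiplied by the variable, and every member tends to 0 there.\<close>

lemma flat_has_derivative:
  "(flat P has_real_derivative flat ([:0, 0, 1:] * (P - pderiv P)) t) (at t)"
proof -
  consider "t > 0" | "t < 0" | "t = 0" by linarith
  then show ?thesis
  proof cases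
    case 1
    have "((\<lambda>t. poly P (1 / t) * exp (- (1 / t))) has_real_derivative
        flat ([:0, 0, 1:] * (P - pderiv P)) t) (at t)"
      using 1 by (auto intro!: derivative_eq_intros DERIV_chain'[OF _ poly_DERIV]
          simp: flat_def field_simps power2_eq_square)
    then show ?thesis
      by (rule has_field_derivative_transform_within_open[where S = "{0<..}"])
        (use 1 in \<open>auto simp: flat_def\<close>)
  next
    case 2
    have "((\<lambda>t. 0) has_real_derivative flat ([:0, 0, 1:] * (P - pderiv P)) t) (at t)"
      using 2 by (auto simp: flat_def)
    then show ?thesis
      by (rule has_field_derivative_transform_within_open[where S = "{..<0}"])
        (use 2 in \<open>auto simp: flat_def\<close>)
  next
    case 3
    have "((\<lambda>h. flat ([:0, 1:] * P) h) \<longlongrightarrow> 0) (at 0)" by (rule flat_tendsto_0)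
    then have "((\<lambda>h. (flat P (0 + h) - flat P 0) / h) \<longlongrightarrow> 0) (at 0)"
      by (rule Lim_transform_eventually) (auto simp: flat_def eventually_at_filter)
    then show ?thesis using 3 by (simp add: DERIV_def flat_def)
  qed
qed

lemma C_n_flat_affine: "C_n n (\<lambda>z. c * flat P (a * fst z + b * snd z + d))"
proof (induction n arbitrary: c P)
  case 0
  have "continuous_on UNIV (flat P)"
    by (rule DERIV_continuous_on[OF has_field_derivative_at_within[OF flat_has_derivative]])
  then show ?case
    by (auto intro!: continuous_intros continuous_on_compose2[of UNIV "flat P"])
next
  case (Suc n)
  let ?Q = "[:0, 0, 1:] * (P - pderiv P)"
  have x: "pdx (\<lambda>z. c * flat P (a * fst z + b * snd z + d)) =
      (\<lambda>z. (c * a) * flat ?Q (a * fst z + b * snd z + d))"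
    by (rule pdx_eqI) (auto intro!: derivative_eq_intros DERIV_chain'[OF _ flat_has_derivative])
  have y: "pdy (\<lambda>z. c * flat P (a * fst z + b * snd z + d)) =
      (\<lambda>z. (c * b) * flat ?Q (a * fst z + b * snd z + d))"
    by (rule pdy_eqI) (auto intro!: derivative_eq_intros DERIV_chain'[OF _ flat_has_derivative])
  have "flat P differentiable at t" for t
    using flat_has_derivative real_differentiable_def by blast
  moreover have "(\<lambda>z. a * fst z + b * snd z + d) differentiable at z" for z :: "real \<times> real"
    unfolding differentiable_def by (rule exI) (rule derivative_intros)+
  ultimately have "(\<lambda>z. c * flat P (a * fst z + b * snd z + d)) differentiable at z" for z
    by (intro differentiable_mult differentiable_const
        differentiable_compose[where f = "flat P" and g = "\<lambda>z. a * fst z + b * snd z + d"])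
  then show ?case unfolding C_n.simps x y using Suc by blast
qed

text \<open>Scaling the argument by \<open>n\<close> replaces \<open>exp (- 1 / t)\<close> by its \<open>n\<close>-th root, which tends to 1
wherever \<open>t > 0\<close>. Hence these test functions are bounded by 1 and converge pointwise to the indicator
of the box, without any normalisation or mollification.\<close>

definition box_bump :: "nat \<Rightarrow> real \<times> real \<Rightarrow> real \<times> real \<Rightarrow> real \<times> real \<Rightarrow> real" where
  "box_bump n a b z =
     flat 1 (real n * (fst z - fst a)) * flat 1 (real n * (fst b - fst z)) *
     (flat 1 (real n * (snd z - snd a)) * flat 1 (real n * (snd b - snd z)))"

lemma box_bump_C_n: "C_n m (box_bump n a b)"
proof -
  have "C_n m (\<lambda>z. flat 1 (real n * (fst z - c)))" for c
    using C_n_flat_affine[of m 1 1 "real n" 0 "- real n * c"] by (simp add: algebra_simps)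
  moreover have "C_n m (\<lambda>z. flat 1 (real n * (c - fst z)))" for c
    using C_n_flat_affine[of m 1 1 "- real n" 0 "real n * c"] by (simp add: algebra_simps)
  moreover have "C_n m (\<lambda>z. flat 1 (real n * (snd z - c)))" for c
    using C_n_flat_affine[of m 1 1 0 "real n" "- real n * c"] by (simp add: algebra_simps)
  moreover have "C_n m (\<lambda>z. flat 1 (real n * (c - snd z)))" for c
    using C_n_flat_affine[of m 1 1 0 "- real n" "real n * c"] by (simp add: algebra_simps)
  ultimately show ?thesis unfolding box_bump_def[abs_def] by (intro C_n_mult)
qed

lemma mem_box_pair:
  "z \<in> box a b \<longleftrightarrow> fst a < fst z \<and> fst z < fst b \<and> snd a < snd z \<and> snd z < snd (b::real\<times>real)"
  by (cases a, cases b, cases z) (auto simp: box_def Basis_prod_def)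

lemma box_bump_outside: "z \<notin> box a b \<Longrightarrow> box_bump n a b z = 0"
  by (cases "n = 0") (auto simp: box_bump_def flat_def mem_box_pair zero_less_mult_iff)

lemma box_bump_bound: "\<bar>box_bump n a b z\<bar> \<le> 1"
proof -
  have "\<bar>flat 1 t\<bar> \<le> 1" for t by (auto simp: flat_def)
  then show ?thesis unfolding box_bump_def abs_mult
    by (intro mult_le_one mult_nonneg_nonneg abs_ge_zero)
qed

lemma box_bump_tendsto: "(\<lambda>n. box_bump n a b z) \<longlonglongrightarrow> indicator (box a b) z"
proof (cases "z \<in> box a b")
  case True
  have f: "(\<lambda>n. flat 1 (real n * t)) \<longlonglongrightarrow> 1" if "t > 0" for t
  proof -
    have "(\<lambda>n. exp (- ((1 / t) * inverse (real n)))) \<longlonglongrightarrow> exp (- ((1 / t) * 0))"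
      by (intro tendsto_intros LIMSEQ_inverse_real_of_nat lim_inverse_n)
    then have "(\<lambda>n. exp (- ((1 / t) * inverse (real n)))) \<longlonglongrightarrow> 1" by simp
    then show ?thesis
      by (rule Lim_transform_eventually)
        (use that in \<open>auto simp: flat_def field_simps intro!: eventually_mono[OF eventually_gt_at_top[of 0]]\<close>)
  qed
  have "(\<lambda>n. box_bump n a b z) \<longlonglongrightarrow> 1 * 1 * (1 * 1)"
    unfolding box_bump_def using True by (intro tendsto_mult f) (auto simp: mem_box_pair)
  then show ?thesis using True by simp
qed (simp add: box_bump_outside)

lemma box_bump_test_function:
  assumes "cbox a b \<subseteq> \<Omega>"
  shows "box_bump n a b \<in> test_functions \<Omega>"
proof -
  have "closure {z. box_bump n a b z \<noteq> 0} \<subseteq> cbox a b"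
    by (rule closure_minimal) (use box_subset_cbox box_bump_outside in blast)+
  then show ?thesis unfolding test_functions_def
    using assms box_bump_C_n by (auto intro: compact_closure[THEN iffD2] bounded_subset[OF bounded_cbox] closure_subset[THEN subsetD])
qed

section \<open>Classical derivatives are weak derivatives\<close>

lemma lborel_integral_translate:
  fixes f :: "'a::euclidean_space \<Rightarrow> real"
  assumes "f \<in> borel_measurable borel"
  shows "(LINT z|lborel. f (z + c)) = (LINT z|lborel. f z)"
proof -
  have "(LINT z|lborel. f z) = (LINT z|distr lborel borel ((+) c). f z)"
    by (simp add: lborel_distr_plus)
  also have "\<dots> = (LINT z|lborel. f (c + z))"
    using assms by (subst integral_distr) auto
  finally show ?thesis by (simp add: add.commute)
qed

lemma integrable_continuous_compact_support:
  fixes h :: "'a::euclidean_space \<Rightarrow> real"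
  assumes "continuous_on UNIV h" "compact C" "\<And>z. z \<notin> C \<Longrightarrow> h z = 0"
  shows "integrable lborel h"
proof -
  have "integrable lborel (\<lambda>x. indicator C x *\<^sub>R h x)"
    using assms continuous_on_subset by (blast intro: borel_integrable_compact)
  moreover have "(\<lambda>x. indicator C x *\<^sub>R h x) = h"
    using assms(3) by (auto simp: fun_eq_iff indicator_def)
  ultimately show ?thesis by simp
qed

lemma has_directional_derivative_along_line:
  fixes w :: "'a::real_normed_vector \<Rightarrow> real"
  assumes "\<And>z. ((\<lambda>t. w (z + t *\<^sub>R e)) has_real_derivative w' z) (at 0)"
  shows "((\<lambda>t. w (z + t *\<^sub>R e)) has_real_derivative w' (z + s *\<^sub>R e)) (at s)"
proof -
  have "((\<lambda>t. w ((z + s *\<^sub>R e) + t *\<^sub>R e)) has_real_derivative w' (z + s *\<^sub>R e)) (at 0)"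
    by (rule assms)
  then have "((\<lambda>t. w (z + (t + s) *\<^sub>R e)) has_real_derivative w' (z + s *\<^sub>R e)) (at 0)"
    by (simp add: algebra_simps)
  then show ?thesis
    using DERIV_shift[of "\<lambda>t. w (z + t *\<^sub>R e)" "w' (z + s *\<^sub>R e)" 0 s] by simp
qed

text \<open>The integral of the difference quotient of \<open>w\<close> vanishes because Lebesgue measure is invariant
under translation. The quotients are bounded uniformly by the mean value theorem and have a common
bounded support, so dominated convergence passes this on to the derivative. This treats both
coordinate directions at once and avoids Fubini's theorem.\<close>

lemma integral_directional_derivative_eq_0:
  fixes w w' :: "'a::euclidean_space \<Rightarrow> real"
  assumes w: "continuous_on UNIV w" and w': "continuous_on UNIV w'"
    and C: "compact C" and w0: "\<And>z. z \<notin> C \<Longrightarrow> w z = 0" and w'0: "\<And>z. z \<notin> C \<Longrightarrow> w' z = 0"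
    and d: "\<And>z. ((\<lambda>t. w (z + t *\<^sub>R e)) has_real_derivative w' z) (at 0)"
  shows "(LINT z|lborel. w' z) = 0"
proof -
  define h where "h n = inverse (real (Suc n))" for n
  have h: "0 < h n" "h n \<le> 1" for n by (auto simp: h_def divide_simps)
  have h0: "h \<longlonglongrightarrow> 0" unfolding h_def by (rule LIMSEQ_inverse_real_of_nat)
  define q where "q n z = (w (z + h n *\<^sub>R e) - w z) / h n" for n z
  have wm: "w \<in> borel_measurable borel" and w'm: "w' \<in> borel_measurable borel"
    using w w' by (auto intro: borel_measurable_continuous_onI)
  have wi: "integrable lborel w"
    using w C w0 by (rule integrable_continuous_compact_support)
  have shift: "integrable lborel (\<lambda>z. w (z + c))" for c
  proof (rule integrable_continuous_compact_support)
    show "continuous_on UNIV (\<lambda>z. w (z + c))"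
      by (rule continuous_on_compose2[OF w]) (auto intro: continuous_intros)
    show "compact ((\<lambda>x. x - c) ` C)"
      by (intro compact_continuous_image continuous_intros C)
    show "w (z + c) = 0" if "z \<notin> (\<lambda>x. x - c) ` C" for z
      by (rule w0) (use that image_iff in fastforce)
  qed
  have q0: "(LINT z|lborel. q n z) = 0" for n
    using shift wi lborel_integral_translate[OF wm, of "h n *\<^sub>R e"]
    by (simp add: q_def)
  obtain M where M: "\<bar>w' z\<bar> \<le> M" for z
  proof -
    have "bounded (w' ` C)"
      by (rule compact_imp_bounded[OF compact_continuous_image[OF continuous_on_subset[OF w'] C]]) simp
    then obtain M where "\<And>z. z \<in> C \<Longrightarrow> \<bar>w' z\<bar> \<le> M" unfolding bounded_iff by auto
    then have "\<bar>w' z\<bar> \<le> max M 0" for z using w'0[of z] by (cases "z \<in> C") force+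
    then show ?thesis using that by blast
  qed
  have qM: "\<bar>q n z\<bar> \<le> M" for n z
  proof -
    have "\<exists>s. s > 0 \<and> s < h n \<and> w (z + h n *\<^sub>R e) - w (z + 0 *\<^sub>R e) = (h n - 0) * w' (z + s *\<^sub>R e)"
      by (rule MVT2[OF h(1)]) (rule has_directional_derivative_along_line[OF d])
    then obtain s where "w (z + h n *\<^sub>R e) - w z = h n * w' (z + s *\<^sub>R e)" by auto
    then show ?thesis using h[of n] M by (simp add: q_def)
  qed
  obtain R where R: "C \<subseteq> cball 0 R"
    using compact_imp_bounded[OF C] unfolding bounded_iff by (auto simp: subset_iff)
  have qR: "q n z = 0" if "z \<notin> cball 0 (R + norm e)" for n z
  proof -
    have "norm (h n *\<^sub>R e) \<le> norm e" using h[of n] by (simp add: mult_left_le_one_le)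
    moreover have "norm z \<le> norm (z + h n *\<^sub>R e) + norm (h n *\<^sub>R e)"
      using norm_triangle_ineq4[of "z + h n *\<^sub>R e" "h n *\<^sub>R e"] by simp
    ultimately have "z + h n *\<^sub>R e \<notin> cball 0 R" "z \<notin> cball 0 R"
      using that norm_ge_zero[of e] unfolding mem_cball_0 by linarith+
    then have "z + h n *\<^sub>R e \<notin> C" "z \<notin> C" using R by auto
    then show ?thesis using w0 by (simp add: q_def)
  qed
  have "(\<lambda>n. LINT z|lborel. q n z) \<longlonglongrightarrow> (LINT z|lborel. w' z)"
  proof (rule integral_dominated_convergence[where w = "\<lambda>z. M * indicator (cball 0 (R + norm e)) z"])
    show "w' \<in> borel_measurable lborel" using w'm by simp
    show "q n \<in> borel_measurable lborel" for n
      using wm unfolding q_def by measurable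
    show "integrable lborel (\<lambda>z. M * indicator (cball 0 (R + norm e)) z)"
      by (intro integrable_mult_right) (auto intro!: emeasure_bounded_finite)
    show "AE z in lborel. (\<lambda>n. q n z) \<longlonglongrightarrow> w' z"
    proof (rule AE_I2)
      fix z
      have "((\<lambda>t. (w (z + t *\<^sub>R e) - w z) / t) \<longlongrightarrow> w' z) (at 0)"
        using d[of z] unfolding DERIV_def by simp
      moreover have "filterlim h (at 0) sequentially"
        using h0 h(1) by (auto simp: filterlim_at less_imp_neq[symmetric] intro!: always_eventually)
      ultimately show "(\<lambda>n. q n z) \<longlonglongrightarrow> w' z"
        unfolding q_def by (rule filterlim_compose)
    qed
    show "AE z in lborel. norm (q n z) \<le> M * indicator (cball 0 (R + norm e)) z" for n
      using qM qR by (auto simp: indicator_def)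
  qed
  then show ?thesis using q0 LIMSEQ_unique[OF _ tendsto_const] by auto
qed

text \<open>The product vanishes on the open complement of \<open>C\<close>, which together with \<open>\<Omega>\<close> covers the space:
this glues to a globally continuous function although nothing is known about \<open>g\<close> near the boundary.\<close>

lemma continuous_on_cutoff:
  fixes g \<psi> :: "'a::euclidean_space \<Rightarrow> real"
  assumes "open \<Omega>" "compact C" "C \<subseteq> \<Omega>" "continuous_on \<Omega> g" "continuous_on UNIV \<psi>"
    and 0: "\<And>z. z \<notin> C \<Longrightarrow> \<psi> z = 0"
  shows "continuous_on UNIV (\<lambda>z. indicator \<Omega> z * (g z * \<psi> z))" (is "continuous_on UNIV ?h")
proof -
  have "continuous_on \<Omega> (\<lambda>z. g z * \<psi> z)"
    using assms continuous_on_subset by (blast intro: continuous_on_mult)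
  then have "continuous_on \<Omega> ?h"
    by (rule continuous_on_eq) auto
  moreover have "continuous_on (- C) ?h"
    by (rule continuous_on_eq[where f = "\<lambda>_. 0"]) (auto simp: 0)
  ultimately have "continuous_on (\<Omega> \<union> - C) ?h"
    using assms by (intro continuous_on_open_Un) (auto simp: compact_imp_closed)
  moreover have "\<Omega> \<union> - C = UNIV" using assms by auto
  ultimately show ?thesis by simp
qed

lemma integration_by_parts_directional:
  fixes f f' \<phi> \<phi>' :: "'a::euclidean_space \<Rightarrow> real"
  assumes \<Omega>: "open \<Omega>" "compact C" "C \<subseteq> \<Omega>"
    and f: "continuous_on \<Omega> f" "continuous_on \<Omega> f'"
      "\<And>z. z \<in> \<Omega> \<Longrightarrow> ((\<lambda>t. f (z + t *\<^sub>R e)) has_real_derivative f' z) (at 0)"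
    and \<phi>: "continuous_on UNIV \<phi>" "continuous_on UNIV \<phi>'"
      "\<And>z. z \<notin> C \<Longrightarrow> \<phi> z = 0" "\<And>z. z \<notin> C \<Longrightarrow> \<phi>' z = 0"
      "\<And>z. ((\<lambda>t. \<phi> (z + t *\<^sub>R e)) has_real_derivative \<phi>' z) (at 0)"
  shows "(LINT z:\<Omega>|lebesgue. f z * \<phi>' z) = - (LINT z:\<Omega>|lebesgue. f' z * \<phi> z)"
proof -
  let ?a = "\<lambda>z. indicator \<Omega> z * (f' z * \<phi> z)" and ?b = "\<lambda>z. indicator \<Omega> z * (f z * \<phi>' z)"
  let ?w = "\<lambda>z. indicator \<Omega> z * (f z * \<phi> z)"
  have cont: "continuous_on UNIV ?a" "continuous_on UNIV ?b" "continuous_on UNIV ?w"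
    using continuous_on_cutoff[OF \<Omega>] f \<phi> by blast+
  have int: "integrable lborel ?a" "integrable lborel ?b"
    by (rule integrable_continuous_compact_support[OF _ \<Omega>(2)]; use cont \<phi> in auto)+
  have "(LINT z|lborel. ?a z + ?b z) = 0"
  proof (rule integral_directional_derivative_eq_0[OF cont(3) _ \<Omega>(2)])
    show "continuous_on UNIV (\<lambda>z. ?a z + ?b z)"
      using cont by (intro continuous_on_add)
    show "((\<lambda>t. ?w (z + t *\<^sub>R e)) has_real_derivative ?a z + ?b z) (at 0)" for z
    proof -
      have line: "continuous_on UNIV (\<lambda>t. z + t *\<^sub>R e)" by (intro continuous_intros)
      show ?thesis
      proof (cases "z \<in> \<Omega>")
        case True
        have "((\<lambda>t. f (z + t *\<^sub>R e) * \<phi> (z + t *\<^sub>R e)) has_real_derivative ?a z + ?b z) (at 0)"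
          by (rule DERIV_cong[OF DERIV_mult[OF f(3)[OF True] \<phi>(5)]]) (use True in simp)
        then show ?thesis
          by (rule has_field_derivative_transform_within_open
              [where S = "(\<lambda>t. z + t *\<^sub>R e) -` \<Omega>"])
            (use True \<Omega>(1) line in \<open>auto simp: continuous_on_open_vimage[OF open_UNIV]\<close>)
      next
        case False
        have "((\<lambda>t. 0) has_real_derivative ?a z + ?b z) (at 0)"
          using False by simp
        then show ?thesis
          by (rule has_field_derivative_transform_within_open
              [where S = "(\<lambda>t. z + t *\<^sub>R e) -` (- C)"])
            (use False \<Omega> \<phi>(3) line in
              \<open>auto simp: continuous_on_open_vimage[OF open_UNIV] open_Compl[OF compact_imp_closed[OF \<Omega>(2)]]
                 simp del: vimage_Compl\<close>)
      qed
    qed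
  qed (use \<phi> in auto)
  then have "(LINT z|lborel. ?b z) = - (LINT z|lborel. ?a z)"
    using int by simp
  moreover have "?a \<in> borel_measurable lborel" "?b \<in> borel_measurable lborel"
    using cont by (auto intro: borel_measurable_continuous_onI)
  ultimately show ?thesis
    unfolding set_lebesgue_integral_def by (simp add: integral_completion)
qed

lemma has_derivative_line_x:
  "((\<lambda>t. f (t, y)) has_real_derivative d) (at x) \<longleftrightarrow>
    ((\<lambda>t. f ((x, y) + t *\<^sub>R (1, 0))) has_real_derivative d) (at 0)"
proof -
  have "f ((x, y) + t *\<^sub>R (1, 0)) = f (t + x, y)" for t by (simp add: add.commute)
  then show ?thesis
    by (simp only:) (rule DERIV_shift[of "\<lambda>t. f (t, y)" d 0 x, unfolded add_0_left])
qed

lemma has_derivative_line_y: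
  "((\<lambda>t. f (x, t)) has_real_derivative d) (at y) \<longleftrightarrow>
    ((\<lambda>t. f ((x, y) + t *\<^sub>R (0, 1))) has_real_derivative d) (at 0)"
proof -
  have "f ((x, y) + t *\<^sub>R (0, 1)) = f (x, t + y)" for t by (simp add: add.commute)
  then show ?thesis
    by (simp only:) (rule DERIV_shift[of "\<lambda>t. f (x, t)" d 0 y, unfolded add_0_left])
qed

lemma partial_derivs_eq_0:
  assumes "open U" "z \<in> U" "\<And>z. z \<in> U \<Longrightarrow> f z = 0"
  shows "pdx f z = 0" "pdy f z = 0"
proof -
  obtain x y where z: "z = (x, y)" by (cases z)
  have "((\<lambda>t. f (t, y)) has_real_derivative 0) (at x)"
    by (rule has_field_derivative_transform_within_open
        [where S = "(\<lambda>t. (t, y)) -` U" and f = "\<lambda>_. 0"])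
      (use assms z in \<open>auto intro!: open_vimage continuous_intros\<close>)
  moreover have "((\<lambda>t. f (x, t)) has_real_derivative 0) (at y)"
    by (rule has_field_derivative_transform_within_open
        [where S = "(\<lambda>t. (x, t)) -` U" and f = "\<lambda>_. 0"])
      (use assms z in \<open>auto intro!: open_vimage continuous_intros\<close>)
  ultimately show "pdx f z = 0" "pdy f z = 0"
    by (auto simp: z pdx_def pdy_def intro: DERIV_imp_deriv)
qed

lemma test_functions_pd:
  assumes "\<phi> \<in> test_functions \<Omega>"
  shows "pdx \<phi> \<in> test_functions \<Omega>" "pdy \<phi> \<in> test_functions \<Omega>"
proof -
  let ?S = "\<lambda>f. closure {z. f z \<noteq> (0::real)}"
  have \<phi>: "\<And>n. C_n n \<phi>" "compact (?S \<phi>)" "?S \<phi> \<subseteq> \<Omega>"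
    using assms by (auto simp: test_functions_def)
  have "C_n n (pdx \<phi>)" "C_n n (pdy \<phi>)" for n
    using \<phi>(1)[of "Suc n"] by auto
  moreover have "?S (pdx \<phi>) \<subseteq> ?S \<phi>" "?S (pdy \<phi>) \<subseteq> ?S \<phi>"
  proof -
    have "\<phi> z = 0" if "z \<in> - ?S \<phi>" for z using that closure_subset[of "{z. \<phi> z \<noteq> 0}"] by auto
    then have "{z. pdx \<phi> z \<noteq> 0} \<subseteq> ?S \<phi>" "{z. pdy \<phi> z \<noteq> 0} \<subseteq> ?S \<phi>"
      using partial_derivs_eq_0[of "- ?S \<phi>" _ \<phi>] by blast+
    then show "?S (pdx \<phi>) \<subseteq> ?S \<phi>" "?S (pdy \<phi>) \<subseteq> ?S \<phi>"
      by (simp_all only: closure_minimal closed_closure)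
  qed
  moreover from this have "compact (?S (pdx \<phi>))" "compact (?S (pdy \<phi>))"
    using \<phi>(2) by (meson closed_closure compact_eq_bounded_closed bounded_subset)+
  ultimately show "pdx \<phi> \<in> test_functions \<Omega>" "pdy \<phi> \<in> test_functions \<Omega>"
    using \<phi>(3) unfolding test_functions_def by blast+
qed

lemma test_functions_pderivs:
  "\<phi> \<in> test_functions \<Omega> \<Longrightarrow> pderivs \<alpha> \<phi> \<in> test_functions \<Omega>"
proof -
  assume \<phi>: "\<phi> \<in> test_functions \<Omega>"
  have y: "(pdy ^^ j) \<phi> \<in> test_functions \<Omega>" for j
    by (induction j) (auto simp: \<phi> test_functions_pd)
  have "(pdx ^^ i) ((pdy ^^ j) \<phi>) \<in> test_functions \<Omega>" for i j
    by (induction i) (auto simp: y test_functions_pd)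
  then show ?thesis by (simp add: pderivs_def)
qed

lemma integration_by_parts_x:
  assumes "open \<Omega>" "\<phi> \<in> test_functions \<Omega>" "continuous_on \<Omega> f" "continuous_on \<Omega> f'"
    and "\<And>x y. (x, y) \<in> \<Omega> \<Longrightarrow> ((\<lambda>t. f (t, y)) has_real_derivative f' (x, y)) (at x)"
  shows "(LINT z:\<Omega>|lebesgue. f z * pdx \<phi> z) = - (LINT z:\<Omega>|lebesgue. f' z * \<phi> z)"
proof -
  let ?C = "closure {z. \<phi> z \<noteq> 0}"
  have c: "C_n n \<phi>" for n using assms(2) by (auto simp: test_functions_def)
  have d: "\<phi> differentiable at z" "continuous_on UNIV (pdx \<phi>)" for z using c[of 1] by (cases z; simp)+
  have 0: "\<phi> z = 0" if "z \<in> - ?C" for z using that closure_subset[of "{z. \<phi> z \<noteq> 0}"] by auto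
  show ?thesis
  proof (rule integration_by_parts_directional[where C = ?C and e = "(1, 0)"])
    show "((\<lambda>t. \<phi> (z + t *\<^sub>R (1, 0))) has_real_derivative pdx \<phi> z) (at 0)" for z
      using has_derivative_slice_x[OF d(1)] has_derivative_line_x by (cases z) blast
    show "((\<lambda>t. f (z + t *\<^sub>R (1, 0))) has_real_derivative f' z) (at 0)" if "z \<in> \<Omega>" for z
      using assms(5) has_derivative_line_x that by (cases z) blast
    show "pdx \<phi> z = 0" if "z \<notin> ?C" for z
      by (rule partial_derivs_eq_0[OF open_Compl[OF closed_closure] _ 0]) (use that in simp_all)
    show "\<phi> z = 0" if "z \<notin> ?C" for z by (rule 0) (use that in simp)
  qed (use assms(1-4) c[of 0, unfolded C_n.simps] d(2) in \<open>simp_all add: test_functions_def\<close>)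
qed

lemma integration_by_parts_y:
  assumes "open \<Omega>" "\<phi> \<in> test_functions \<Omega>" "continuous_on \<Omega> f" "continuous_on \<Omega> f'"
    and "\<And>x y. (x, y) \<in> \<Omega> \<Longrightarrow> ((\<lambda>t. f (x, t)) has_real_derivative f' (x, y)) (at y)"
  shows "(LINT z:\<Omega>|lebesgue. f z * pdy \<phi> z) = - (LINT z:\<Omega>|lebesgue. f' z * \<phi> z)"
proof -
  let ?C = "closure {z. \<phi> z \<noteq> 0}"
  have c: "C_n n \<phi>" for n using assms(2) by (auto simp: test_functions_def)
  have d: "\<phi> differentiable at z" "continuous_on UNIV (pdy \<phi>)" for z using c[of 1] by (cases z; simp)+
  have 0: "\<phi> z = 0" if "z \<in> - ?C" for z using that closure_subset[of "{z. \<phi> z \<noteq> 0}"] by auto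
  show ?thesis
  proof (rule integration_by_parts_directional[where C = ?C and e = "(0, 1)"])
    show "((\<lambda>t. \<phi> (z + t *\<^sub>R (0, 1))) has_real_derivative pdy \<phi> z) (at 0)" for z
      using has_derivative_slice_y[OF d(1)] has_derivative_line_y by (cases z) blast
    show "((\<lambda>t. f (z + t *\<^sub>R (0, 1))) has_real_derivative f' z) (at 0)" if "z \<in> \<Omega>" for z
      using assms(5) has_derivative_line_y that by (cases z) blast
    show "pdy \<phi> z = 0" if "z \<notin> ?C" for z
      by (rule partial_derivs_eq_0[OF open_Compl[OF closed_closure] _ 0]) (use that in simp_all)
    show "\<phi> z = 0" if "z \<notin> ?C" for z by (rule 0) (use that in simp)
  qed (use assms(1-4) c[of 0, unfolded C_n.simps] d(2) in \<open>simp_all add: test_functions_def\<close>)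
qed

lemma locally_integrable_continuous:
  assumes "continuous_on \<Omega> f"
  shows "locally_integrable \<Omega> f"
  unfolding locally_integrable_def set_integrable_def
proof (intro allI impI)
  fix C assume C: "compact C \<and> C \<subseteq> \<Omega>"
  then have "integrable lborel (\<lambda>z. indicator C z *\<^sub>R f z)"
    by (intro borel_integrable_compact) (auto intro: continuous_on_subset[OF assms])
  then show "integrable lebesgue (\<lambda>z. indicator C z *\<^sub>R f z)"
    by (simp add: integrable_completion borel_measurable_integrable)
qed

lemma is_weak_deriv_order_0: "continuous_on \<Omega> f \<Longrightarrow> is_weak_deriv (0, 0) \<Omega> f f"
  by (simp add: is_weak_deriv_def pderivs_def locally_integrable_continuous)

lemma is_weak_deriv_zero: "is_weak_deriv \<alpha> \<Omega> (\<lambda>_. 0) (\<lambda>_. 0)"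
  by (simp add: is_weak_deriv_def locally_integrable_continuous set_lebesgue_integral_def)

text \<open>A test function paired with \<open>pderivs (Suc i, j)\<close> is paired with the \<open>x\<close> derivative of another
test function, so one integration by parts lowers the order. The operator \<^const>\<open>pderivs\<close> applies
\<open>x\<close> derivatives last, hence they are the ones to be moved first.\<close>

lemma is_weak_deriv_Suc_x:
  assumes "open \<Omega>" "continuous_on \<Omega> f" "continuous_on \<Omega> f'"
    and "\<And>x y. (x, y) \<in> \<Omega> \<Longrightarrow> ((\<lambda>t. f (t, y)) has_real_derivative f' (x, y)) (at x)"
    and "is_weak_deriv (i, j) \<Omega> f' v"
  shows "is_weak_deriv (Suc i, j) \<Omega> f v"
proof -
  have "(LINT z:\<Omega>|lebesgue. f z * pderivs (Suc i, j) \<phi> z) =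
      (- 1) ^ (Suc i + j) * (LINT z:\<Omega>|lebesgue. v z * \<phi> z)" if \<phi>: "\<phi> \<in> test_functions \<Omega>" for \<phi>
  proof -
    have "(LINT z:\<Omega>|lebesgue. f z * pderivs (Suc i, j) \<phi> z) =
        - (LINT z:\<Omega>|lebesgue. f' z * pderivs (i, j) \<phi> z)"
      using integration_by_parts_x[OF assms(1) test_functions_pderivs[OF \<phi>, of "(i, j)"] assms(2-4)]
      by (simp add: pderivs_def)
    then show ?thesis using assms(5) \<phi> by (simp add: is_weak_deriv_def)
  qed
  then show ?thesis
    using assms by (simp add: is_weak_deriv_def locally_integrable_continuous)
qed

lemma is_weak_deriv_Suc_y:
  assumes "open \<Omega>" "continuous_on \<Omega> f" "continuous_on \<Omega> f'"
    and "\<And>x y. (x, y) \<in> \<Omega> \<Longrightarrow> ((\<lambda>t. f (x, t)) has_real_derivative f' (x, y)) (at y)"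
    and "is_weak_deriv (0, j) \<Omega> f' v"
  shows "is_weak_deriv (0, Suc j) \<Omega> f v"
proof -
  have "(LINT z:\<Omega>|lebesgue. f z * pderivs (0, Suc j) \<phi> z) =
      (- 1) ^ Suc j * (LINT z:\<Omega>|lebesgue. v z * \<phi> z)" if \<phi>: "\<phi> \<in> test_functions \<Omega>" for \<phi>
  proof -
    have "(LINT z:\<Omega>|lebesgue. f z * pderivs (0, Suc j) \<phi> z) =
        - (LINT z:\<Omega>|lebesgue. f' z * pderivs (0, j) \<phi> z)"
      using integration_by_parts_y[OF assms(1) test_functions_pderivs[OF \<phi>, of "(0, j)"] assms(2-4)]
      by (simp add: pderivs_def)
    then show ?thesis using assms(5) \<phi> by (simp add: is_weak_deriv_def)
  qed
  then show ?thesis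
    using assms by (simp add: is_weak_deriv_def locally_integrable_continuous)
qed

section \<open>Weak derivatives are unique almost everywhere\<close>

text \<open>Lebesgue differentiation: at almost every point the value of \<open>f\<close> is the limit of its averages over
small cubes, and all of these vanish.\<close>

lemma AE_eq_0_if_box_integrals_eq_0:
  fixes f :: "'a::euclidean_space \<Rightarrow> real"
  assumes f: "set_integrable lebesgue (cbox a b) f"
    and 0: "\<And>c d. cbox c d \<subseteq> cbox a b \<Longrightarrow> (LINT z:box c d|lebesgue. f z) = 0"
  shows "AE z in lebesgue. z \<in> box a b \<longrightarrow> f z = 0"
proof -
  let ?g = "\<lambda>z. if z \<in> cbox a b then f z else 0"
  have "?g absolutely_integrable_on UNIV"
    using f by (simp add: absolutely_integrable_restrict_UNIV)
  then have ai: "?g absolutely_integrable_on cbox c d" for c d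
    by (rule set_integrable_subset) auto
  then have "?g integrable_on cbox c d" for c d
    using set_lebesgue_integral_eq_integral(1) by blast
  then obtain N where N: "negligible N"
    "\<And>x e. \<lbrakk>x \<notin> N; 0 < e\<rbrakk> \<Longrightarrow> \<exists>d>0. \<forall>h. 0 < h \<and> h < d \<longrightarrow>
       norm (integral (cbox x (x + h *\<^sub>R One)) ?g /\<^sub>R h ^ DIM('a) - ?g x) < e"
    using integrable_ccontinuous_explicit by blast
  have "f x = 0" if x: "x \<in> box a b" "x \<notin> N" for x
  proof (rule ccontr)
    assume fx: "f x \<noteq> 0"
    then obtain d where d: "d > 0" "\<And>h. 0 < h \<Longrightarrow> h < d \<Longrightarrow>
       norm (integral (cbox x (x + h *\<^sub>R One)) ?g /\<^sub>R h ^ DIM('a) - ?g x) < \<bar>f x\<bar>"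
      using N(2)[OF x(2), of "\<bar>f x\<bar>"] by auto
    define m where "m = Min ((\<lambda>i. b \<bullet> i - x \<bullet> i) ` Basis)"
    have m: "m > 0" "\<And>i. i \<in> Basis \<Longrightarrow> m \<le> b \<bullet> i - x \<bullet> i"
      using x(1) by (auto simp: m_def mem_box)
    define h where "h = min (d / 2) m"
    have h: "0 < h" "h < d" "h \<le> m" using d m by (auto simp: h_def)
    have sub: "cbox x (x + h *\<^sub>R One) \<subseteq> cbox a b"
      using x(1) h m(2) by (fastforce simp: mem_box inner_add_left)
    let ?B = "box x (x + h *\<^sub>R One)"
    have "integral (cbox x (x + h *\<^sub>R One)) ?g = integral ?B ?g"
      by (rule integral_open_interval[symmetric])
    also have "\<dots> = (LINT z:?B|lebesgue. ?g z)"
      by (rule set_lebesgue_integral_eq_integral(2)[symmetric])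
        (rule set_integrable_subset[OF ai[of x "x + h *\<^sub>R One"]], auto simp: box_subset_cbox)
    also have "\<dots> = (LINT z:?B|lebesgue. f z)"
      using sub box_subset_cbox by (intro set_lebesgue_integral_cong) auto
    also have "\<dots> = 0" by (rule 0[OF sub])
    finally show False using d(2)[OF h(1,2)] x(1) subsetD[OF box_subset_cbox x(1)] by simp
  qed
  then have "{z. \<not> (z \<in> box a b \<longrightarrow> f z = 0)} \<subseteq> N" by blast
  then show ?thesis
    using N(1) by (intro AE_I'[of N]) (auto simp: negligible_iff_null_sets)
qed

text \<open>Bump functions approximate the indicator of every box in \<open>\<Omega>\<close>, so all box integrals of \<open>f\<close> vanish
by dominated convergence.\<close>

lemma fundamental_lemma_calculus_of_variations:
  assumes \<Omega>: "open \<Omega>" and f: "locally_integrable \<Omega> f"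
    and 0: "\<And>\<phi>. \<phi> \<in> test_functions \<Omega> \<Longrightarrow> (LINT z:\<Omega>|lebesgue. f z * \<phi> z) = 0"
  shows "AE z in lebesgue. z \<in> \<Omega> \<longrightarrow> f z = 0"
proof -
  have box0: "(LINT z:box c d|lebesgue. f z) = 0" if cd: "cbox c d \<subseteq> \<Omega>" for c d
  proof -
    have i: "set_integrable lebesgue (cbox c d) f"
      using f cd by (simp add: locally_integrable_def)
    then have i': "integrable lebesgue (\<lambda>z. indicator (cbox c d) z * f z)"
      by (simp add: set_integrable_def)
    then have im: "(\<lambda>z. indicator (cbox c d) z * f z) \<in> borel_measurable lebesgue"
      by blast
    have bm: "box_bump n c d \<in> borel_measurable lebesgue" for n
      using box_bump_C_n[of 0 n c d] by (auto intro!: borel_measurable_continuous_onI measurable_completion)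
    have eq: "indicator \<Omega> z *\<^sub>R (f z * box_bump n c d z) =
        indicator (cbox c d) z * f z * box_bump n c d z" for n z
      using cd box_subset_cbox[of c d] box_bump_outside[of z c d n]
      by (cases "z \<in> box c d") (auto simp: indicator_def)
    have "(\<lambda>n. LINT z|lebesgue. indicator \<Omega> z *\<^sub>R (f z * box_bump n c d z)) \<longlonglongrightarrow>
        (LINT z|lebesgue. indicator (box c d) z *\<^sub>R f z)"
    proof (rule integral_dominated_convergence
        [where w = "\<lambda>z. norm (indicator (cbox c d) z * f z)"])
      have "set_integrable lebesgue (box c d) f"
        by (rule set_integrable_subset[OF i]) (auto simp: box_subset_cbox)
      then show "(\<lambda>z. indicator (box c d) z *\<^sub>R f z) \<in> borel_measurable lebesgue"
        unfolding set_integrable_def by blast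
      show "(\<lambda>z. indicator \<Omega> z *\<^sub>R (f z * box_bump n c d z)) \<in> borel_measurable lebesgue" for n
        unfolding eq using im bm by (rule borel_measurable_times)
      show "integrable lebesgue (\<lambda>z. norm (indicator (cbox c d) z * f z))"
        using i' by (rule integrable_norm)
      show "AE z in lebesgue. (\<lambda>n. indicator \<Omega> z *\<^sub>R (f z * box_bump n c d z))
          \<longlonglongrightarrow> indicator (box c d) z *\<^sub>R f z"
      proof (rule AE_I2)
        fix z
        have "(\<lambda>n. indicator (cbox c d) z * f z * box_bump n c d z)
            \<longlonglongrightarrow> indicator (cbox c d) z * f z * indicator (box c d) z"
          by (intro tendsto_intros box_bump_tendsto)
        also have "indicator (cbox c d) z * f z * indicator (box c d) z = indicator (box c d) z *\<^sub>R f z"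
          using box_subset_cbox[of c d] by (auto simp: indicator_def)
        finally show "(\<lambda>n. indicator \<Omega> z *\<^sub>R (f z * box_bump n c d z))
          \<longlonglongrightarrow> indicator (box c d) z *\<^sub>R f z" by (simp only: eq)
      qed
      show "AE z in lebesgue. norm (indicator \<Omega> z *\<^sub>R (f z * box_bump n c d z))
          \<le> norm (indicator (cbox c d) z * f z)" for n
      proof (rule AE_I2)
        fix z
        have "norm (indicator (cbox c d) z * f z * box_bump n c d z)
            \<le> norm (indicator (cbox c d) z * f z) * 1"
          unfolding norm_mult[of _ "box_bump n c d z"]
          using box_bump_bound by (intro mult_left_mono) auto
        then show "norm (indicator \<Omega> z *\<^sub>R (f z * box_bump n c d z))
          \<le> norm (indicator (cbox c d) z * f z)" by (simp only: eq mult_1_right)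
      qed
    qed
    moreover have "(LINT z|lebesgue. indicator \<Omega> z *\<^sub>R (f z * box_bump n c d z)) = 0" for n
      using 0[OF box_bump_test_function[OF cd, of n]] by (simp add: set_lebesgue_integral_def)
    ultimately show ?thesis
      using LIMSEQ_unique[OF _ tendsto_const] by (auto simp: set_lebesgue_integral_def)
  qed
  obtain \<D> where \<D>: "countable \<D>" "\<D> \<subseteq> Pow \<Omega>" "\<And>X. X \<in> \<D> \<Longrightarrow> \<exists>a b. X = cbox a b" "\<Union>\<D> = \<Omega>"
    using open_countable_Union_open_cbox[OF \<Omega>] by metis
  have "AE z in lebesgue. z \<in> X \<longrightarrow> f z = 0" if X: "X \<in> \<D>" for X
  proof -
    obtain a b where ab: "X = cbox a b" "cbox a b \<subseteq> \<Omega>" using \<D> X by blast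
    have "AE z in lebesgue. z \<in> box a b \<longrightarrow> f z = 0"
      by (rule AE_eq_0_if_box_integrals_eq_0)
        (use f ab box0 in \<open>auto simp: locally_integrable_def\<close>)
    moreover have "AE z in lebesgue. z \<notin> cbox a b - box a b"
      using negligible_frontier_interval
      by (intro AE_not_in) (auto simp: negligible_iff_null_sets)
    ultimately show ?thesis by eventually_elim (use ab in auto)
  qed
  then have "AE z in lebesgue. \<forall>X\<in>\<D>. z \<in> X \<longrightarrow> f z = 0"
    using \<D>(1) by (subst AE_ball_countable) auto
  then show ?thesis by eventually_elim (use \<D>(4) in auto)
qed

lemma test_function_times_locally_integrable:
  assumes f: "locally_integrable \<Omega> f" and \<phi>: "\<phi> \<in> test_functions \<Omega>"
  shows "set_integrable lebesgue \<Omega> (\<lambda>z. f z * \<phi> z)"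
proof -
  let ?C = "closure {z. \<phi> z \<noteq> 0}"
  have C: "compact ?C" "?C \<subseteq> \<Omega>" "C_n 0 \<phi>" using \<phi> by (auto simp: test_functions_def)
  have out: "\<phi> z = 0" if "z \<notin> ?C" for z using that closure_subset[of "{z. \<phi> z \<noteq> 0}"] by auto
  have i: "integrable lebesgue (\<lambda>z. indicator ?C z * f z)"
    using f C by (simp add: locally_integrable_def set_integrable_def)
  have m: "\<phi> \<in> borel_measurable lebesgue"
    using C(3) by (auto intro!: borel_measurable_continuous_onI measurable_completion)
  obtain M where M: "\<And>z. z \<in> ?C \<Longrightarrow> \<bar>\<phi> z\<bar> \<le> M"
  proof -
    have "bounded (\<phi> ` ?C)"
      by (rule compact_imp_bounded[OF compact_continuous_image[OF _ C(1)]])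
        (use C(3) continuous_on_subset in auto)
    then show ?thesis using that unfolding bounded_iff by auto
  qed
  have eq: "(\<lambda>z. indicator \<Omega> z *\<^sub>R (f z * \<phi> z)) = (\<lambda>z. indicator ?C z * f z * \<phi> z)"
  proof
    fix z show "indicator \<Omega> z *\<^sub>R (f z * \<phi> z) = indicator ?C z * f z * \<phi> z"
      using out[of z] C(2) by (cases "z \<in> ?C") (auto simp: indicator_def)
  qed
  show ?thesis unfolding set_integrable_def eq
  proof (rule Bochner_Integration.integrable_bound)
    show "integrable lebesgue (\<lambda>z. M * (indicator ?C z * f z))"
      using i by (rule integrable_mult_right)
    show "(\<lambda>z. indicator ?C z * f z * \<phi> z) \<in> borel_measurable lebesgue"
      by (rule borel_measurable_times[OF borel_measurable_integrable[OF i] m])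
    show "AE z in lebesgue. norm (indicator ?C z * f z * \<phi> z) \<le> norm (M * (indicator ?C z * f z))"
    proof (rule AE_I2)
      fix z
      show "norm (indicator ?C z * f z * \<phi> z) \<le> norm (M * (indicator ?C z * f z))"
        using M[of z] mult_right_mono[of "\<bar>\<phi> z\<bar>" "\<bar>M\<bar>" "\<bar>f z\<bar>"]
        by (cases "z \<in> ?C") (auto simp: abs_mult mult.commute)
    qed
  qed
qed

lemma is_weak_deriv_unique:
  assumes \<Omega>: "open \<Omega>" and v: "is_weak_deriv \<alpha> \<Omega> u v" and w: "is_weak_deriv \<alpha> \<Omega> u w"
  shows "AE z in lebesgue. z \<in> \<Omega> \<longrightarrow> v z = w z"
proof -
  have li: "locally_integrable \<Omega> v" "locally_integrable \<Omega> w"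
    using v w by (auto simp: is_weak_deriv_def)
  have "AE z in lebesgue. z \<in> \<Omega> \<longrightarrow> v z - w z = 0"
  proof (rule fundamental_lemma_calculus_of_variations[OF \<Omega>])
    show "locally_integrable \<Omega> (\<lambda>z. v z - w z)"
      using li by (auto simp: locally_integrable_def intro: set_integral_diff)
    fix \<phi> assume \<phi>: "\<phi> \<in> test_functions \<Omega>"
    have "(LINT z:\<Omega>|lebesgue. v z * \<phi> z) = (LINT z:\<Omega>|lebesgue. w z * \<phi> z)"
    proof -
      have "(- 1) ^ (fst \<alpha> + snd \<alpha>) * (LINT z:\<Omega>|lebesgue. v z * \<phi> z) =
          (- 1) ^ (fst \<alpha> + snd \<alpha>) * (LINT z:\<Omega>|lebesgue. w z * \<phi> z)"
        using v w \<phi> unfolding is_weak_deriv_def by simp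
      then show ?thesis by simp
    qed
    then show "(LINT z:\<Omega>|lebesgue. (v z - w z) * \<phi> z) = 0"
      using set_integral_diff(2)[OF test_function_times_locally_integrable[OF li(1) \<phi>]
          test_function_times_locally_integrable[OF li(2) \<phi>]]
      by (simp add: algebra_simps)
  qed
  then show ?thesis by eventually_elim auto
qed

lemma weak_deriv_cong:
  assumes "\<And>z. z \<in> \<Omega> \<Longrightarrow> f z = g z"
  shows "weak_deriv \<alpha> \<Omega> f = weak_deriv \<alpha> \<Omega> g"
proof -
  have "locally_integrable \<Omega> f \<longleftrightarrow> locally_integrable \<Omega> g"
    using assms unfolding locally_integrable_def
    by (intro all_cong set_integrable_cong) auto
  moreover have "(LINT z:\<Omega>|lebesgue. f z * h z) = (LINT z:\<Omega>|lebesgue. g z * h z)" for h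
    using assms unfolding set_lebesgue_integral_def
    by (intro Bochner_Integration.integral_cong) (auto simp: indicator_def)
  ultimately have "is_weak_deriv \<alpha> \<Omega> f = is_weak_deriv \<alpha> \<Omega> g"
    unfolding is_weak_deriv_def fun_eq_iff by simp
  then show ?thesis by (simp add: weak_deriv_def)
qed

lemma borel_measurable_open_continuous:
  fixes v :: "'a::euclidean_space \<Rightarrow> real"
  assumes "open \<Omega>" "continuous_on \<Omega> v"
  shows "(\<lambda>z. indicator \<Omega> z *\<^sub>R v z) \<in> borel_measurable borel"
  using assms by (intro borel_measurable_continuous_on_indicator) auto

text \<open>This removes the choice operator from the seminorm: a continuous classical derivative may be
integrated in place of the chosen weak derivative. The measure changes to \<^const>\<open>lborel\<close>
because continuous functions are Borel measurable.\<close>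

lemma weak_deriv_Lp_integral:
  assumes \<Omega>: "open \<Omega>" and v: "is_weak_deriv \<alpha> \<Omega> u v" and c: "continuous_on \<Omega> v" and p: "p > 0"
  shows "(LINT z:\<Omega>|lebesgue. \<bar>weak_deriv \<alpha> \<Omega> u z\<bar> powr p) = (LINT z:\<Omega>|lborel. \<bar>v z\<bar> powr p)"
proof -
  have "is_weak_deriv \<alpha> \<Omega> u (weak_deriv \<alpha> \<Omega> u)"
    unfolding weak_deriv_def using someI[of "is_weak_deriv \<alpha> \<Omega> u", OF v] .
  then have AE: "AE z in lebesgue. z \<in> \<Omega> \<longrightarrow> weak_deriv \<alpha> \<Omega> u z = v z"
    by (rule is_weak_deriv_unique[OF \<Omega> _ v])
  have cp: "continuous_on \<Omega> (\<lambda>z. \<bar>v z\<bar> powr p)"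
    using c p by (intro continuous_on_powr' continuous_intros) auto
  have m: "(\<lambda>z. indicator \<Omega> z *\<^sub>R \<bar>v z\<bar> powr p) \<in> borel_measurable borel"
    by (rule borel_measurable_open_continuous[OF \<Omega> cp])
  have ml: "(\<lambda>z. indicator \<Omega> z *\<^sub>R \<bar>v z\<bar> powr p) \<in> borel_measurable lebesgue"
    using m by (simp add: measurable_completion)
  have AE': "AE z in lebesgue. indicator \<Omega> z *\<^sub>R \<bar>v z\<bar> powr p =
      indicator \<Omega> z *\<^sub>R \<bar>weak_deriv \<alpha> \<Omega> u z\<bar> powr p"
    using AE by eventually_elim (auto simp: indicator_def)
  have "(LINT z:\<Omega>|lebesgue. \<bar>weak_deriv \<alpha> \<Omega> u z\<bar> powr p) = (LINT z:\<Omega>|lebesgue. \<bar>v z\<bar> powr p)"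
    unfolding set_lebesgue_integral_def
    using AE' ml borel_measurable_AE[OF ml AE'] by (intro integral_cong_AE) auto
  also have "\<dots> = (LINT z:\<Omega>|lborel. \<bar>v z\<bar> powr p)"
    unfolding set_lebesgue_integral_def using m by (intro integral_completion) simp
  finally show ?thesis .
qed

section \<open>The geometry of the quadrilaterals\<close>

lemma atLeastAtMost_1_4: "{1..4::nat} = {1, 2, 3, 4}"
  by auto

lemma sum_1_4: "sum f {1..4::nat} = f 1 + f 2 + f 3 + (f 4 :: 'a::comm_monoid_add)"
  unfolding atLeastAtMost_1_4 by (simp add: add.assoc)

lemma F_map_K:
  "F_map (K_vertices 1 1 s s) (x, y) = (x * (1 - (1 - s) * y), y * (1 - (1 - s) * x))"
  unfolding F_map_def sum_1_4
  by (simp add: ref_basis_def K_vertices_def algebra_simps)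

text \<open>With \<open>t = 1 - s\<close>, the bilinear map is \<open>F(x, y) = (x (1 - t y), y (1 - t x))\<close> and its Jacobian
determinant is \<open>1 - t (x + y)\<close>. Since \<open>X - Y = x - y\<close>, inverting \<open>F\<close> amounts to solving one quadratic
equation, whose discriminant is the radicand below and has the Jacobian as its root: \<open>jac t\<close> is the
Jacobian determinant as a function on the physical element.\<close>

definition jac :: "real \<Rightarrow> real \<times> real \<Rightarrow> real" where
  "jac t = (\<lambda>(X, Y). sqrt (1 - 2 * t * (X + Y) + t\<^sup>2 * (X - Y)\<^sup>2))"

definition F_inverse :: "real \<Rightarrow> real \<times> real \<Rightarrow> real \<times> real" where
  "F_inverse t = (\<lambda>(X, Y). (((1 - jac t (X, Y)) / t + (X - Y)) / 2, ((1 - jac t (X, Y)) / t - (X - Y)) / 2))"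

definition K_polygon :: "real \<Rightarrow> (real \<times> real) set" where
  "K_polygon s = {(X, Y). 0 \<le> X \<and> 0 \<le> Y \<and> s * X + (1 - s) * Y \<le> s \<and> (1 - s) * X + s * Y \<le> s}"

context
  fixes s t :: real
  assumes s: "1 / 2 < s" "s \<le> 5 / 8" and t: "t = 1 - s"
begin

lemma jac_F_map:
  assumes "(x, y) \<in> ref_square"
  shows "jac t (F_map (K_vertices 1 1 s s) (x, y)) = 1 - t * (x + y)"
proof -
  have "t * (x + y) \<le> 1 / 2 * 2"
    using assms s t by (intro mult_mono) (auto simp: ref_square_def)
  moreover have "1 - 2 * t * (x * (1 - t * y) + y * (1 - t * x)) + t\<^sup>2 * (x * (1 - t * y) - y * (1 - t * x))\<^sup>2
      = (1 - t * (x + y))\<^sup>2"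
    by algebra
  ultimately show ?thesis
    using real_sqrt_unique[of "1 - t * (x + y)"] by (simp add: jac_def F_map_K t)
qed

lemma F_inverse_F_map:
  assumes "z \<in> ref_square"
  shows "F_inverse t (F_map (K_vertices 1 1 s s) z) = z"
proof -
  obtain x y where z: "z = (x, y)" by (cases z)
  have "t > 0" using s t by simp
  then show ?thesis
    using jac_F_map[of x y] assms
    by (simp add: z F_inverse_def F_map_K t[symmetric] field_simps)
qed

text \<open>The radicand equals \<open>(1 - 2 t + t \<bar>X - Y\<bar>)\<^sup>2\<close> plus a multiple of the slack in one of the two slanted
edge inequalities, and \<open>(1 \<plusminus> t (X - Y))\<^sup>2\<close> minus a multiple of \<open>X\<close> or \<open>Y\<close>. The four edges thus give the
bounds that place \<open>F_inverse\<close> inside the reference square.\<close>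

lemma K_polygon_bounds:
  assumes "(X, Y) \<in> K_polygon s"
  shows "X \<le> 1" "Y \<le> 1"
    and "0 \<le> 1 - 2 * t * (X + Y) + t\<^sup>2 * (X - Y)\<^sup>2"
    and "1 - 2 * t + t * \<bar>X - Y\<bar> \<le> jac t (X, Y)"
    and "jac t (X, Y) \<le> 1 + t * (X - Y)" "jac t (X, Y) \<le> 1 - t * (X - Y)"
proof -
  have z: "0 \<le> X" "0 \<le> Y" "s * X + t * Y \<le> s" "t * X + s * Y \<le> s"
    using assms by (auto simp: K_polygon_def t)
  have t0: "0 < t" "t < 1/2" "s = 1 - t" using s t by auto
  have "s * X \<le> s * 1" "s * Y \<le> s * 1"
    using z t0 mult_nonneg_nonneg[of t X] mult_nonneg_nonneg[of t Y] by linarith+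
  then show XY: "X \<le> 1" "Y \<le> 1" using s by simp_all
  have m: "(X + Y) / 2 + (s - t) * \<bar>X - Y\<bar> / 2 \<le> s"
  proof (cases "X \<ge> Y")
    case True
    then have "(X + Y) / 2 + (s - t) * \<bar>X - Y\<bar> / 2 = s * X + t * Y"
      unfolding t0(3) by (simp add: field_simps)
    then show ?thesis using z(3) by simp
  next
    case False
    then have "(X + Y) / 2 + (s - t) * \<bar>X - Y\<bar> / 2 = t * X + s * Y"
      unfolding t0(3) by (simp add: field_simps)
    then show ?thesis using z(4) by simp
  qed
  have "(1 - 2 * t + t * \<bar>X - Y\<bar>)\<^sup>2 = 1 - 2 * t * (X + Y) + t\<^sup>2 * (X - Y)\<^sup>2 -
      4 * t * (s - ((X + Y) / 2 + (s - t) * \<bar>X - Y\<bar> / 2))"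
    unfolding t0(3) power2_abs[of "X - Y", symmetric] by (simp add: power2_eq_square field_simps)
  moreover have "0 \<le> 4 * t * (s - ((X + Y) / 2 + (s - t) * \<bar>X - Y\<bar> / 2))"
    using m t0 by (intro mult_nonneg_nonneg) auto
  ultimately have le: "(1 - 2 * t + t * \<bar>X - Y\<bar>)\<^sup>2 \<le> 1 - 2 * t * (X + Y) + t\<^sup>2 * (X - Y)\<^sup>2"
    by linarith
  then show "1 - 2 * t + t * \<bar>X - Y\<bar> \<le> jac t (X, Y)"
    by (simp add: jac_def real_le_rsqrt)
  show "0 \<le> 1 - 2 * t * (X + Y) + t\<^sup>2 * (X - Y)\<^sup>2"
    using le zero_le_power2 order_trans by blast
  have d: "\<bar>t * (X - Y)\<bar> \<le> 1/2 * 1"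
    unfolding abs_mult using t0 z XY by (intro mult_mono) auto
  have "1 - 2 * t * (X + Y) + t\<^sup>2 * (X - Y)\<^sup>2 = (1 + t * (X - Y))\<^sup>2 - 4 * t * X"
    "1 - 2 * t * (X + Y) + t\<^sup>2 * (X - Y)\<^sup>2 = (1 - t * (X - Y))\<^sup>2 - 4 * t * Y"
    by algebra+
  then have "1 - 2 * t * (X + Y) + t\<^sup>2 * (X - Y)\<^sup>2 \<le> (1 + t * (X - Y))\<^sup>2"
    "1 - 2 * t * (X + Y) + t\<^sup>2 * (X - Y)\<^sup>2 \<le> (1 - t * (X - Y))\<^sup>2"
    using mult_nonneg_nonneg[of t X] mult_nonneg_nonneg[of t Y] z t0 by linarith+
  then show "jac t (X, Y) \<le> 1 + t * (X - Y)" "jac t (X, Y) \<le> 1 - t * (X - Y)"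
    using d by (auto simp: jac_def intro!: real_le_lsqrt)
qed

lemma jac_pos: "z \<in> K_polygon s \<Longrightarrow> 0 < jac t z"
proof -
  assume z: "z \<in> K_polygon s"
  obtain X Y where "z = (X, Y)" by (cases z)
  moreover have "0 < 1 - 2 * t + t * \<bar>X - Y\<bar>" using s t by (auto intro!: add_pos_nonneg)
  ultimately show ?thesis using K_polygon_bounds(4)[of X Y] z by simp
qed

lemma F_inverse_in_square:
  assumes "z \<in> K_polygon s"
  shows "F_inverse t z \<in> ref_square"
proof -
  obtain X Y where z: "z = (X, Y)" by (cases z)
  have t0: "t > 0" using s t by simp
  have "(1 - jac t (X, Y)) / t \<le> 2 - \<bar>X - Y\<bar>"
    "- (X - Y) \<le> (1 - jac t (X, Y)) / t" "X - Y \<le> (1 - jac t (X, Y)) / t"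
    unfolding pos_divide_le_eq[OF t0] pos_le_divide_eq[OF t0]
    using K_polygon_bounds(4-6)[of X Y] assms by (simp_all add: z algebra_simps)
  then show ?thesis
    unfolding z F_inverse_def ref_square_def prod.case mem_Times_iff fst_conv snd_conv atLeastAtMost_iff
    by (auto simp: abs_le_iff)
qed

lemma F_map_F_inverse:
  assumes "z \<in> K_polygon s"
  shows "F_map (K_vertices 1 1 s s) (F_inverse t z) = z"
proof -
  obtain X Y where z: "z = (X, Y)" by (cases z)
  define D where "D = jac t (X, Y)"
  have t0: "t > 0" using s t by simp
  have D: "D\<^sup>2 = 1 - 2 * t * (X + Y) + t\<^sup>2 * (X - Y)\<^sup>2"
    using K_polygon_bounds(3)[of X Y] assms by (simp add: D_def jac_def z)
  define x where "x = ((1 - D) / t + (X - Y)) / 2"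
  define y where "y = ((1 - D) / t - (X - Y)) / 2"
  have tx: "2 * (t * x) = 1 - D + t * (X - Y)" and ty: "2 * (t * y) = 1 - D - t * (X - Y)"
    using t0 by (simp_all add: x_def y_def field_simps)
  have "4 * t * (x * (1 - t * y)) = (2 * (t * x)) * (2 - 2 * (t * y))" by algebra
  also have "\<dots> = 4 * t * X"
    unfolding tx ty using D by algebra
  finally have 1: "x * (1 - t * y) = X" using t0 by simp
  have "4 * t * (y * (1 - t * x)) = (2 * (t * y)) * (2 - 2 * (t * x))" by algebra
  also have "\<dots> = 4 * t * Y"
    unfolding tx ty using D by algebra
  finally have 2: "y * (1 - t * x) = Y" using t0 by simp
  show ?thesis using 1 2 by (simp add: z F_inverse_def F_map_K t[symmetric] D_def[symmetric] x_def[symmetric] y_def[symmetric])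
qed

text \<open>A point of the polygon is \<open>F\<close> of a point of the square, and \<open>F\<close> is by definition a convex combination
of the vertices; this replaces a search for barycentric weights.\<close>

lemma quad_K: "quad (K_vertices 1 1 s s) = K_polygon s"
proof
  have h: "convex {z::real\<times>real. a \<bullet> z \<le> b}" for a b by (rule convex_halfspace_le)
  have eq: "K_polygon s = {z. (- 1, 0) \<bullet> z \<le> 0} \<inter> {z. (0, - 1) \<bullet> z \<le> 0} \<inter>
      {z. (s, 1 - s) \<bullet> z \<le> s} \<inter> {z. (1 - s, s) \<bullet> z \<le> s}"
    by (auto simp: K_polygon_def)
  have "convex (K_polygon s)"
    unfolding eq by (intro convex_Int h)
  then show "quad (K_vertices 1 1 s s) \<subseteq> K_polygon s"
    unfolding quad_def atLeastAtMost_1_4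
    by (intro hull_minimal) (use s in \<open>auto simp: K_vertices_def K_polygon_def algebra_simps\<close>)
  show "K_polygon s \<subseteq> quad (K_vertices 1 1 s s)"
  proof
    fix z assume z: "z \<in> K_polygon s"
    obtain x y where xy: "F_inverse t z = (x, y)" by (cases "F_inverse t z")
    have sq: "0 \<le> x" "x \<le> 1" "0 \<le> y" "y \<le> 1"
      using F_inverse_in_square[OF z] by (auto simp: xy ref_square_def)
    have "F_map (K_vertices 1 1 s s) (x, y) \<in> convex hull (K_vertices 1 1 s s ` {1..4})"
      unfolding F_map_def
    proof (rule convex_sum)
      show "sum (\<lambda>i. ref_basis i (x, y)) {1..4} = 1"
        unfolding sum_1_4 by (simp add: ref_basis_def algebra_simps)
      show "0 \<le> ref_basis i (x, y)" for i
        using sq by (auto simp: ref_basis_def)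
    qed (auto intro: hull_inc)
    then show "z \<in> quad (K_vertices 1 1 s s)"
      using F_map_F_inverse[OF z] by (simp add: xy quad_def)
  qed
qed

lemma inv_into_F_map:
  assumes "z \<in> K_polygon s"
  shows "inv_into ref_square (F_map (K_vertices 1 1 s s)) z = F_inverse t z"
proof (rule inv_into_f_eq)
  show "inj_on (F_map (K_vertices 1 1 s s)) ref_square"
    by (rule inj_on_inverseI[where g = "F_inverse t"]) (rule F_inverse_F_map)
qed (use assms F_inverse_in_square F_map_F_inverse in auto)

lemma interior_K:
  assumes "0 < X" "0 < Y" "s * X + (1 - s) * Y < s" "(1 - s) * X + s * Y < s"
  shows "(X, Y) \<in> interior (K_polygon s)"
proof -
  let ?U = "{z. 0 < fst z} \<inter> {z. 0 < snd z} \<inter> {z. s * fst z + (1 - s) * snd z < s} \<inter>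
      {z. (1 - s) * fst z + s * snd z < s}"
  have "open ?U"
    by (intro open_Int open_Collect_less continuous_intros)
  moreover have "?U \<subseteq> K_polygon s" by (auto simp: K_polygon_def)
  ultimately have "?U \<subseteq> interior (K_polygon s)" by (rule interior_maximal[rotated])
  then show ?thesis using assms by auto
qed

lemma has_derivative_F_inverse:
  assumes "(X, Y) \<in> K_polygon s"
  shows "((\<lambda>Y. fst (F_inverse t (X, Y))) has_real_derivative
      t * fst (F_inverse t (X, Y)) / jac t (X, Y)) (at Y)"
    and "((\<lambda>Y. snd (F_inverse t (X, Y))) has_real_derivative
      (1 - t * snd (F_inverse t (X, Y))) / jac t (X, Y)) (at Y)"
proof -
  have t0: "t > 0" using s t by simp
  have D: "0 < jac t (X, Y)" using assms by (rule jac_pos)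
  then have D': "0 < 1 - 2 * t * (X + Y) + t\<^sup>2 * (X - Y)\<^sup>2" by (simp add: jac_def)
  have "((\<lambda>Y. jac t (X, Y)) has_real_derivative - (t + t\<^sup>2 * (X - Y)) / jac t (X, Y)) (at Y)"
    unfolding jac_def prod.case using D'
    by (auto intro!: derivative_eq_intros simp: field_simps power2_eq_square)
  note [derivative_intros] = this
  show "((\<lambda>Y. fst (F_inverse t (X, Y))) has_real_derivative
      t * fst (F_inverse t (X, Y)) / jac t (X, Y)) (at Y)"
    unfolding F_inverse_def using D t0
    by (auto intro!: derivative_eq_intros simp: field_simps power2_eq_square)
  show "((\<lambda>Y. snd (F_inverse t (X, Y))) has_real_derivative
      (1 - t * snd (F_inverse t (X, Y))) / jac t (X, Y)) (at Y)"
    unfolding F_inverse_def using D t0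
    by (auto intro!: derivative_eq_intros simp: field_simps power2_eq_square)
qed

end

section \<open>Biquadratic Lagrange interpolation\<close>

definition lagr :: "nat \<Rightarrow> real \<Rightarrow> real" where
  "lagr i x = (if i = 0 then (1 - x) * (1 - 2 * x) else if i = 1 then 4 * x * (1 - x) else x * (2 * x - 1))"

definition lagr' :: "nat \<Rightarrow> real \<Rightarrow> real" where
  "lagr' i x = (if i = 0 then 4 * x - 3 else if i = 1 then 4 - 8 * x else 4 * x - 1)"

lemma lagr_has_derivative: "(lagr i has_real_derivative lagr' i x) (at x within A)"
proof -
  consider "i = 0" | "i = 1" | "i \<noteq> 0" "i \<noteq> 1" by blast
  then show ?thesis
    unfolding lagr_def[abs_def] lagr'_def
    by cases (simp_all, (rule derivative_eq_intros refl | simp add: algebra_simps)+)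
qed

lemma sum_atMost_2: "(\<Sum>i\<le>(2::nat). f i) = f 0 + f 1 + (f 2 :: real)"
  by (simp add: numeral_2_eq_2)

lemma quadratic_lagrange:
  "a + b * x + c * x\<^sup>2 = (\<Sum>i\<le>2. (a + b * (real i / 2) + c * (real i / 2)\<^sup>2) * lagr i x)"
  by (simp add: sum_atMost_2 lagr_def power2_eq_square field_simps)

text \<open>The quadratic interpolation formula, applied in each variable separately. It shows unisolvence of
the nine nodes.\<close>

lemma poly_Q_2_lagrange:
  assumes "q \<in> poly_Q 2"
  shows "q (x, y) = (\<Sum>i\<le>2. \<Sum>j\<le>2. q (real i / 2, real j / 2) * lagr i x * lagr j y)"
proof -
  obtain c where c: "\<And>x y. q (x, y) = (\<Sum>i\<le>2. \<Sum>j\<le>2. c i j * x ^ i * y ^ j)"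
    using assms unfolding poly_Q_def by blast
  have qx: "q (x, y) = (\<Sum>j\<le>2. c 0 j * y ^ j) + (\<Sum>j\<le>2. c 1 j * y ^ j) * x + (\<Sum>j\<le>2. c 2 j * y ^ j) * x\<^sup>2" for x y
    unfolding c sum_atMost_2 by (simp add: algebra_simps)
  have qy: "q (x, y) = (\<Sum>i\<le>2. c i 0 * x ^ i) + (\<Sum>i\<le>2. c i 1 * x ^ i) * y + (\<Sum>i\<le>2. c i 2 * x ^ i) * y\<^sup>2" for x y
    unfolding c sum_atMost_2 by (simp add: algebra_simps)
  have "q (x, y) = (\<Sum>i\<le>2. q (real i / 2, y) * lagr i x)"
    unfolding qx by (rule quadratic_lagrange)
  also have "\<dots> = (\<Sum>i\<le>2. (\<Sum>j\<le>2. q (real i / 2, real j / 2) * lagr j y) * lagr i x)"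
    unfolding qy by (subst quadratic_lagrange) (rule refl)
  finally show ?thesis by (simp add: sum_distrib_left mult_ac)
qed

lemma lagrange_interp_2:
  "lagrange_interp 2 f (x, y) = (\<Sum>i\<le>2. \<Sum>j\<le>2. f (real i / 2, real j / 2) * lagr i x * lagr j y)"
proof -
  define q where "q = (\<lambda>(x, y). \<Sum>i\<le>2. \<Sum>j\<le>2. f (real i / 2, real j / 2) * lagr i x * lagr j y)"
  define l where "l i k = (if i = 0 then (if k = 0 then 1 else if k = 1 then - 3 else 2)
     else if i = 1 then (if k = 0 then 0 else if k = 1 then 4 else - 4)
     else (if k = 0 then 0 else if k = 1 then - 1 else (2::real)))" for i k :: nat
  have l: "lagr i x = (\<Sum>k\<le>2. l i k * x ^ k)" for i x
    by (simp add: sum_atMost_2 lagr_def l_def algebra_simps power2_eq_square)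
  have "q \<in> poly_Q 2"
    unfolding poly_Q_def
  proof (intro CollectI exI allI)
    fix x y
    show "q (x, y) = (\<Sum>k\<le>2. \<Sum>m\<le>2. (\<Sum>i\<le>2. \<Sum>j\<le>2. f (real i / 2, real j / 2) * l i k * l j m) * x ^ k * y ^ m)"
      unfolding q_def prod.case l sum_atMost_2 by (simp add: algebra_simps)
  qed
  moreover have node: "q (real j / 2, real i / 2) = f (real j / 2, real i / 2)" if "i \<le> 2" "j \<le> 2" for i j
  proof -
    have "i = 0 \<or> i = 1 \<or> i = 2" "j = 0 \<or> j = 1 \<or> j = 2" using that by auto
    then show ?thesis unfolding q_def prod.case sum_atMost_2 by (elim disjE) (simp_all add: lagr_def)
  qed
  ultimately have "lagrange_interp 2 f = q"
    unfolding lagrange_interp_def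
  proof (intro the_equality conjI allI impI)
    fix r assume r: "r \<in> poly_Q 2 \<and> (\<forall>i\<le>2. \<forall>j\<le>2. r (real j / real 2, real i / real 2) = f (real j / real 2, real i / real 2))"
    show "r = q"
    proof
      fix z show "r z = q z"
      proof (cases z)
        case (Pair x y)
        have "r (x, y) = (\<Sum>i\<le>2. \<Sum>j\<le>2. r (real i / 2, real j / 2) * lagr i x * lagr j y)"
          using r by (intro poly_Q_2_lagrange) auto
        also have "\<dots> = q (x, y)"
          using r unfolding q_def prod.case by (intro sum.cong) auto
        finally show ?thesis by (simp add: Pair)
      qed
    qed
  qed auto
  then show ?thesis by (simp add: q_def)
qed

section \<open>The angles\<close>

lemma internal_angles_K:
  assumes "1 / 2 < s" "s \<le> 5 / 8"
  shows "internal_angle (K_vertices 1 1 s s) (Suc 0) = pi / 2"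
    and "internal_angle (K_vertices 1 1 s s) 2 = arccos ((1 - s) / sqrt (s\<^sup>2 + (1 - s)\<^sup>2))"
    and "internal_angle (K_vertices 1 1 s s) 3 = arccos (- (2 * s * (1 - s)) / (s\<^sup>2 + (1 - s)\<^sup>2))"
    and "internal_angle (K_vertices 1 1 s s) 4 = arccos ((1 - s) / sqrt (s\<^sup>2 + (1 - s)\<^sup>2))"
proof -
  have sym: "(s - 1)\<^sup>2 = (1 - s)\<^sup>2" by (rule power2_commute)
  note defs = internal_angle_def next_vertex_def prev_vertex_def K_vertices_def norm_prod_def
  show "internal_angle (K_vertices 1 1 s s) (Suc 0) = pi / 2"
    by (simp add: defs)
  show "internal_angle (K_vertices 1 1 s s) 2 = arccos ((1 - s) / sqrt (s\<^sup>2 + (1 - s)\<^sup>2))"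
    by (simp add: defs sym add.commute)
  show "internal_angle (K_vertices 1 1 s s) 3 = arccos (- (2 * s * (1 - s)) / (s\<^sup>2 + (1 - s)\<^sup>2))"
    by (simp add: defs sym add.commute) (simp add: algebra_simps)
  show "internal_angle (K_vertices 1 1 s s) 4 = arccos ((1 - s) / sqrt (s\<^sup>2 + (1 - s)\<^sup>2))"
    by (simp add: defs sym add.commute)
qed

lemma sum_of_squares_ge:
  fixes s :: real
  shows "2 * s * (1 - s) \<le> s\<^sup>2 + (1 - s)\<^sup>2" "0 < s\<^sup>2 + (1 - s)\<^sup>2"
proof -
  have "s\<^sup>2 + (1 - s)\<^sup>2 - 2 * s * (1 - s) = (2 * s - 1)\<^sup>2"
    by (simp add: power2_eq_square algebra_simps)
  then show "2 * s * (1 - s) \<le> s\<^sup>2 + (1 - s)\<^sup>2" using zero_le_power2[of "2 * s - 1"] by linarith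
  show "0 < s\<^sup>2 + (1 - s)\<^sup>2" by (cases "s = 0") (auto intro: add_pos_nonneg)
qed

lemma mac_K:
  assumes "1 / 2 < s" "s \<le> 5 / 8"
  shows "mac (pi / 4) (K_vertices 1 1 s s)"
proof -
  let ?q = "s\<^sup>2 + (1 - s)\<^sup>2"
  have q: "0 < ?q" by (rule sum_of_squares_ge)
  have "convex_quadrilateral (K_vertices 1 1 s s)"
    using assms by (auto simp: convex_quadrilateral_def atLeastAtMost_1_4 K_vertices_def cross2_def
        next_vertex_def prev_vertex_def algebra_simps)
  moreover have "pi / 4 \<le> arccos c" if "- 1 \<le> c" "c \<le> sqrt 2 / 2" for c
  proof -
    have "sqrt 2 \<le> (2::real)" by (rule real_le_lsqrt) auto
    then have "arccos (cos (pi / 4)) \<le> arccos c"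
      using that by (intro arccos_le_arccos) (auto simp: cos_45 cos_ge_minus_one)
    then show ?thesis by (simp add: arccos_cos)
  qed
  note arc = this
  have "pi / 4 \<le> arccos ((1 - s) / sqrt ?q)"
  proof (rule arc)
    have "(1 - s)\<^sup>2 \<le> s\<^sup>2" using assms by (intro power_mono) auto
    then have "(1 - s)\<^sup>2 / ?q \<le> 1 / 2" using q by (simp add: field_simps)
    then have "sqrt ((1 - s)\<^sup>2 / ?q) \<le> sqrt (1 / 2)" by simp
    moreover have "sqrt ((1 - s)\<^sup>2 / ?q) = (1 - s) / sqrt ?q"
      using assms by (simp add: real_sqrt_divide)
    moreover have "sqrt (1 / 2) = sqrt 2 / (2::real)"
      by (simp add: real_sqrt_divide field_simps)
    ultimately show "(1 - s) / sqrt ?q \<le> sqrt 2 / 2" by simp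
    have "0 \<le> (1 - s) / sqrt ?q" using assms q by (intro divide_nonneg_nonneg) auto
    then show "- 1 \<le> (1 - s) / sqrt ?q" by linarith
  qed
  moreover have "pi / 4 \<le> arccos (- (2 * s * (1 - s)) / ?q)"
  proof (rule arc)
    show "- 1 \<le> - (2 * s * (1 - s)) / ?q"
      using q sum_of_squares_ge(1)[of s] by (simp add: field_simps)
    have "- (2 * s * (1 - s)) / ?q \<le> 0"
      using assms q by (intro divide_nonpos_pos) auto
    then show "- (2 * s * (1 - s)) / ?q \<le> sqrt 2 / 2"
      by (rule order_trans) simp
  qed
  ultimately show ?thesis
    unfolding mac_def atLeastAtMost_1_4 by (simp add: internal_angles_K[OF assms])
qed

lemma max_angle_K_tendsto:
  "((\<lambda>s. max_angle (K_vertices 1 1 s s)) \<longlongrightarrow> pi) (at_right (1 / 2))"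
proof (rule tendsto_sandwich)
  let ?f = "\<lambda>s::real. - (2 * s * (1 - s)) / (s\<^sup>2 + (1 - s)\<^sup>2)"
  have c: "- 1 \<le> ?f s \<and> ?f s \<le> 1 \<and> \<bar>(1 - s) / sqrt (s\<^sup>2 + (1 - s)\<^sup>2)\<bar> \<le> 1"
    if s: "1 / 2 < s" "s \<le> 5 / 8" for s :: real
  proof -
    have q: "0 < s\<^sup>2 + (1 - s)\<^sup>2" by (rule sum_of_squares_ge)
    have "- 1 \<le> ?f s" using q sum_of_squares_ge(1)[of s] by (simp add: field_simps)
    moreover have "?f s \<le> 0" using s q by (intro divide_nonpos_pos) auto
    moreover have "\<bar>1 - s\<bar> \<le> sqrt (s\<^sup>2 + (1 - s)\<^sup>2)" by (rule real_le_rsqrt) simp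
    then have "\<bar>(1 - s) / sqrt (s\<^sup>2 + (1 - s)\<^sup>2)\<bar> \<le> 1"
      using q by (simp add: abs_divide)
    ultimately show ?thesis unfolding abs_le_iff by linarith
  qed
  have ev: "\<forall>\<^sub>F s in at_right (1/2). (1::real)/2 < s \<and> s \<le> 5/8"
    by (auto simp: eventually_at_right_field intro!: exI[of _ "5/8"])
  have fin: "finite (internal_angle V ` {1..4})" for V by simp
  show "\<forall>\<^sub>F s in at_right (1/2). arccos (?f s) \<le> max_angle (K_vertices 1 1 s s)"
    using ev
  proof eventually_elim
    case (elim s)
    have "internal_angle (K_vertices 1 1 s s) 3 \<le> max_angle (K_vertices 1 1 s s)"
      unfolding max_angle_def by (rule Max_ge[OF fin]) auto
    then show ?case using elim internal_angles_K(3) by simp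
  qed
  show "\<forall>\<^sub>F s in at_right (1/2). max_angle (K_vertices 1 1 s s) \<le> pi"
    using ev
  proof eventually_elim
    case (elim s)
    then have "1/2 < s" "s \<le> 5/8" by auto
    note angles = internal_angles_K[OF this] and bounds = c[OF this]
    have "internal_angle (K_vertices 1 1 s s) 2 \<le> pi" "internal_angle (K_vertices 1 1 s s) 3 \<le> pi"
      "internal_angle (K_vertices 1 1 s s) 4 \<le> pi"
      unfolding angles using bounds abs_le_D2[of "(1 - s) / sqrt (s\<^sup>2 + (1 - s)\<^sup>2)" 1]
      by (intro arccos_ubound; linarith)+
    then show ?case
      unfolding max_angle_def atLeastAtMost_1_4
      by (subst Max_le_iff) (simp_all add: angles(1))
  qed
  \<comment> \<open>At the limit \<open>s = 1/2\<close> the third vertex lies on the segment between its neighbours, where the cosine is -1.\<close>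
  have "isCont ?f (1/2)"
    by (intro continuous_intros) (simp add: power2_eq_square)
  then have "(?f \<longlongrightarrow> - 1) (at (1/2))"
    unfolding isCont_def by (simp add: power2_eq_square)
  then have "(?f \<longlongrightarrow> - 1) (at_right (1/2))" by (rule tendsto_within_subset) simp
  then have "((\<lambda>s. arccos (?f s)) \<longlongrightarrow> arccos (- 1)) (at_right (1/2))"
  proof (rule continuous_on_tendsto_compose[OF continuous_on_arccos'])
    show "\<forall>\<^sub>F s in at_right (1/2). ?f s \<in> {- 1..1}"
      using ev by eventually_elim (use c in simp)
  qed simp
  then show "((\<lambda>s. arccos (?f s)) \<longlongrightarrow> pi) (at_right (1/2))" by simp
qed simp

section \<open>The interpolation error of a polynomial in the first variable\<close>

text \<open>Derivatives are stripped in \<open>x\<close> first; a remaining \<open>y\<close> derivative annihilates a function of \<open>x\<close>.\<close>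

lemma is_weak_deriv_poly_fst:
  assumes \<Omega>: "open \<Omega>"
  shows "is_weak_deriv (i, j) \<Omega> (\<lambda>z. poly P (fst z))
    (if j = 0 then (\<lambda>z. poly ((pderiv ^^ i) P) (fst z)) else (\<lambda>_. 0))"
proof (induction i arbitrary: P)
  case 0
  show ?case
  proof (cases j)
    case 0
    then show ?thesis by (auto intro!: is_weak_deriv_order_0 continuous_intros)
  next
    case (Suc k)
    have "is_weak_deriv (0, Suc k) \<Omega> (\<lambda>z. poly P (fst z)) (\<lambda>_. 0)"
      by (rule is_weak_deriv_Suc_y[where f' = "\<lambda>_. 0"])
        (auto intro!: \<Omega> continuous_intros is_weak_deriv_zero)
    then show ?thesis by (simp add: Suc)
  qed
next
  case (Suc i)
  have "is_weak_deriv (Suc i, j) \<Omega> (\<lambda>z. poly P (fst z))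
    (if j = 0 then (\<lambda>z. poly ((pderiv ^^ i) (pderiv P)) (fst z)) else (\<lambda>_. 0))"
    by (rule is_weak_deriv_Suc_x[where f' = "\<lambda>z. poly (pderiv P) (fst z)"])
      (auto intro!: \<Omega> continuous_intros poly_DERIV simp: Suc[of "pderiv P", simplified])
  then show ?case by (simp only: funpow.simps o_apply funpow_swap1)
qed

lemma sobolev_seminorm_poly_fst_le:
  assumes p: "1 \<le> p" and K: "interior K \<subseteq> cbox (0, 0) (1, 1)" and M: "0 \<le> M"
    and P: "\<And>x. 0 \<le> x \<Longrightarrow> x \<le> 1 \<Longrightarrow> \<bar>poly ((pderiv ^^ m) P) x\<bar> \<le> M"
  shows "sobolev_seminorm m p K (\<lambda>z. poly P (fst z)) \<le> M"
proof -
  let ?\<Omega> = "interior K"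
  define A where "A = (LINT z:?\<Omega>|lborel. \<bar>poly ((pderiv ^^ m) P) (fst z)\<bar> powr p)"
  have "(LINT z:?\<Omega>|lebesgue. \<bar>weak_deriv (i, m - i) ?\<Omega> (\<lambda>z. poly P (fst z)) z\<bar> powr p) =
      (if i = m then A else 0)" if "i \<le> m" for i
  proof -
    have "(LINT z:?\<Omega>|lebesgue. \<bar>weak_deriv (i, m - i) ?\<Omega> (\<lambda>z. poly P (fst z)) z\<bar> powr p) =
      (LINT z:?\<Omega>|lborel. \<bar>(if m - i = 0 then (\<lambda>z. poly ((pderiv ^^ i) P) (fst z)) else (\<lambda>_. 0)) z\<bar> powr p)"
      using p by (intro weak_deriv_Lp_integral is_weak_deriv_poly_fst)
        (auto intro!: continuous_intros)
    then show ?thesis using that p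
      by (auto simp: A_def set_lebesgue_integral_def)
  qed
  then have "sobolev_seminorm m p K (\<lambda>z. poly P (fst z)) = (\<Sum>i\<le>m. if i = m then A else 0) powr (1 / p)"
    unfolding sobolev_seminorm_def by simp
  also have "(\<Sum>i\<le>m. if i = m then A else 0) = A" by simp
  also have "A powr (1 / p) \<le> (M powr p) powr (1 / p)"
  proof (rule powr_mono2)
    show "0 \<le> A" unfolding A_def set_lebesgue_integral_def by simp
    have "A \<le> (LINT z|lborel. indicator (cbox (0, 0) (1, 1)) (z::real\<times>real) * (M powr p))"
      unfolding A_def set_lebesgue_integral_def
    proof (rule integral_mono')
      show "integrable lborel (\<lambda>z. indicator (cbox (0, 0) (1, 1)) (z::real\<times>real) * (M powr p))"
        by (intro integrable_mult_left) (auto intro!: emeasure_bounded_finite)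
      fix z :: "real \<times> real"
      show "indicator ?\<Omega> z *\<^sub>R \<bar>poly ((pderiv ^^ m) P) (fst z)\<bar> powr p
          \<le> indicator (cbox (0, 0) (1, 1)) z * (M powr p)"
      proof (cases "z \<in> ?\<Omega>")
        case True
        then have "z \<in> cbox (0, 0) (1, 1)" using K by blast
        moreover from this have "0 \<le> fst z" "fst z \<le> 1"
          by (cases z; simp add: cbox_Pair_eq)+
        then have "\<bar>poly ((pderiv ^^ m) P) (fst z)\<bar> powr p \<le> M powr p"
          using p P by (intro powr_mono2) auto
        ultimately show ?thesis using True by simp
      qed simp
    qed simp
    also have "\<dots> = M powr p"
      by (simp add: content_Pair measure_lborel_cbox_eq Basis_prod_def)
    finally show "A \<le> M powr p" .
  qed (use p in simp)
  also have "(M powr p) powr (1 / p) = M"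
    using p M by (simp add: powr_powr)
  finally show ?thesis .
qed

text \<open>The value of the interpolated function at \<open>F(i / 2, j / 2)\<close>, whose first coordinate is
\<open>i / 2 (1 - t j / 2)\<close>.\<close>

definition node_value :: "real poly \<Rightarrow> real \<Rightarrow> nat \<Rightarrow> nat \<Rightarrow> real" where
  "node_value P t i j = poly P (real i / 2 * (1 - t * (real j / 2)))"

definition interpolant :: "real poly \<Rightarrow> real \<Rightarrow> real \<times> real \<Rightarrow> real" where
  "interpolant P t = (\<lambda>(x, y). \<Sum>i\<le>2. \<Sum>j\<le>2. node_value P t i j * lagr i x * lagr j y)"

text \<open>By Cramer's rule, the \<open>Y\<close> derivative of a function \<open>q\<close> of the reference coordinates is
\<open>(t x q\<^sub>x + (1 - t y) q\<^sub>y) / jac\<close>; this is the numerator for the interpolant.\<close>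

definition dY_numer :: "real poly \<Rightarrow> real \<Rightarrow> real \<times> real \<Rightarrow> real" where
  "dY_numer P t = (\<lambda>(x, y). \<Sum>i\<le>2. \<Sum>j\<le>2. node_value P t i j *
     (t * x * lagr' i x * lagr j y + (1 - t * y) * lagr i x * lagr' j y))"

lemma continuous_on_lagr [continuous_intros]:
  assumes "continuous_on A f"
  shows "continuous_on A (\<lambda>z. lagr i (f z))" "continuous_on A (\<lambda>z. lagr' i (f z))"
proof -
  have "continuous_on UNIV (lagr i)"
    by (rule DERIV_continuous_on[OF lagr_has_derivative])
  then show "continuous_on A (\<lambda>z. lagr i (f z))"
    using assms by (rule continuous_on_compose2) simp
  show "continuous_on A (\<lambda>z. lagr' i (f z))"
    unfolding lagr'_def using assms by (cases "i = 0"; cases "i = 1") (auto intro!: continuous_intros)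
qed

lemma continuous_on_dY_numer:
  assumes "continuous_on A T" "continuous_on A x" "continuous_on A y"
  shows "continuous_on A (\<lambda>z. dY_numer P (T z) (x z, y z))"
  unfolding dY_numer_def node_value_def prod.case by (intro continuous_intros assms)

lemma continuous_on_jac: "continuous_on A (jac t)"
proof -
  have "jac t = (\<lambda>z. sqrt (1 - 2 * t * (fst z + snd z) + t\<^sup>2 * (fst z - snd z)\<^sup>2))"
    by (auto simp: jac_def)
  then show ?thesis by (auto intro!: continuous_intros)
qed

lemma continuous_on_F_inverse: "t \<noteq> 0 \<Longrightarrow> continuous_on A (F_inverse t)"
proof -
  assume t: "t \<noteq> 0"
  have "F_inverse t = (\<lambda>z. (((1 - jac t z) / t + (fst z - snd z)) / 2, ((1 - jac t z) / t - (fst z - snd z)) / 2))"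
    by (auto simp: F_inverse_def)
  then show ?thesis using t by (auto intro!: continuous_intros continuous_on_jac)
qed

context
  fixes s t :: real
  assumes s: "1 / 2 < s" "s \<le> 5 / 8" and t: "t = 1 - s"
begin

lemma Q_interp_K:
  assumes "z \<in> K_polygon s"
  shows "Q_interp 2 (K_vertices 1 1 s s) (\<lambda>z. poly P (fst z)) z = interpolant P t (F_inverse t z)"
proof -
  obtain x y where xy: "F_inverse t z = (x, y)" by (cases "F_inverse t z")
  show ?thesis
    unfolding Q_interp_def inv_into_F_map[OF s t assms] xy interpolant_def lagrange_interp_2 prod.case
    by (simp add: F_map_K node_value_def t)
qed

lemma interpolant_has_derivative_y:
  assumes "(X, Y) \<in> K_polygon s"
  shows "((\<lambda>Y. interpolant P t (F_inverse t (X, Y))) has_real_derivative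
    dY_numer P t (F_inverse t (X, Y)) / jac t (X, Y)) (at Y)"
proof -
  define x where "x Y = fst (F_inverse t (X, Y))" for Y
  define y where "y Y = snd (F_inverse t (X, Y))" for Y
  have F: "F_inverse t (X, Y) = (x Y, y Y)" for Y by (simp add: x_def y_def)
  let ?J = "jac t (X, Y)"
  have x: "(x has_real_derivative t * x Y / ?J) (at Y)"
    and y: "(y has_real_derivative (1 - t * y Y) / ?J) (at Y)"
    unfolding x_def y_def by (rule has_derivative_F_inverse[OF s t assms])+
  have lx: "((\<lambda>Y. lagr i (x Y)) has_real_derivative lagr' i (x Y) * (t * x Y / ?J)) (at Y)" for i
    by (rule DERIV_chain2[OF lagr_has_derivative x])
  have ly: "((\<lambda>Y. lagr i (y Y)) has_real_derivative lagr' i (y Y) * ((1 - t * y Y) / ?J)) (at Y)" for i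
    by (rule DERIV_chain2[OF lagr_has_derivative y])
  have summand: "((\<lambda>Y. node_value P t i j * lagr i (x Y) * lagr j (y Y)) has_real_derivative
     node_value P t i j * (t * x Y * lagr' i (x Y) * lagr j (y Y) +
       (1 - t * y Y) * lagr i (x Y) * lagr' j (y Y)) / ?J) (at Y)" for i j
    by (rule DERIV_cong[OF DERIV_mult[OF DERIV_cmult[OF lx] ly]])
      (simp add: add_divide_distrib diff_divide_distrib algebra_simps)
  show ?thesis
    unfolding F interpolant_def dY_numer_def prod.case sum_divide_distrib
    by (intro DERIV_sum summand)
qed

lemma continuous_on_K_quotient: "continuous_on (K_polygon s) (\<lambda>z. - (dY_numer P t (F_inverse t z) / jac t z))"
proof -
  have t0: "t \<noteq> 0" using s t by simp
  note F = continuous_on_F_inverse[OF t0]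
  have "continuous_on (K_polygon s) (\<lambda>z. dY_numer P t (fst (F_inverse t z), snd (F_inverse t z)))"
    by (intro continuous_on_dY_numer continuous_intros F)
  moreover have "\<forall>z\<in>K_polygon s. jac t z \<noteq> 0"
    using jac_pos[OF s t] by (metis less_irrefl)
  ultimately show ?thesis
    by (intro continuous_on_minus continuous_on_divide continuous_on_jac) simp_all
qed

lemma is_weak_deriv_error_y:
  "is_weak_deriv (0, 1) (interior (K_polygon s)) (\<lambda>z. poly P (fst z) - interpolant P t (F_inverse t z))
    (\<lambda>z. - (dY_numer P t (F_inverse t z) / jac t z))"
proof -
  let ?\<Omega> = "interior (K_polygon s)"
  have t0: "t \<noteq> 0" using s t by simp
  note F = continuous_on_F_inverse[OF t0]
  have i: "continuous_on ?\<Omega> (\<lambda>z. interpolant P t (F_inverse t z))"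
    unfolding interpolant_def case_prod_beta by (intro continuous_intros F)
  have c: "continuous_on ?\<Omega> (\<lambda>z. - (dY_numer P t (F_inverse t z) / jac t z))"
    using continuous_on_K_quotient interior_subset by (rule continuous_on_subset)
  have "is_weak_deriv (0, Suc 0) ?\<Omega> (\<lambda>z. poly P (fst z) - interpolant P t (F_inverse t z))
    (\<lambda>z. - (dY_numer P t (F_inverse t z) / jac t z))"
  proof (rule is_weak_deriv_Suc_y[OF open_interior _ c _ is_weak_deriv_order_0[OF c]])
    show "continuous_on ?\<Omega> (\<lambda>z. poly P (fst z) - interpolant P t (F_inverse t z))"
      by (intro continuous_intros i)
    fix X Y assume "(X, Y) \<in> ?\<Omega>"
    then have "(X, Y) \<in> K_polygon s" using interior_subset by blast
    from interpolant_has_derivative_y[OF this, of P]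
    show "((\<lambda>Y. poly P (fst (X, Y)) - interpolant P t (F_inverse t (X, Y))) has_real_derivative
        - (dY_numer P t (F_inverse t (X, Y)) / jac t (X, Y))) (at Y)"
      by (auto intro!: derivative_eq_intros)
  qed
  then show ?thesis by simp
qed

text \<open>The interpolated function does not depend on \<open>Y\<close>, so the \<open>Y\<close> derivative of the error comes from the
interpolant alone. Dropping the other first derivative only decreases the seminorm.\<close>

lemma seminorm_error_ge:
  assumes p: "1 \<le> p"
  shows "(LINT z:interior (K_polygon s)|lborel. \<bar>dY_numer P t (F_inverse t z) / jac t z\<bar> powr p) powr (1 / p)
    \<le> sobolev_seminorm 1 p (quad (K_vertices 1 1 s s))
        (\<lambda>z. poly P (fst z) - Q_interp 2 (K_vertices 1 1 s s) (\<lambda>z. poly P (fst z)) z)"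
proof -
  let ?\<Omega> = "interior (K_polygon s)"
  let ?e = "\<lambda>z. poly P (fst z) - Q_interp 2 (K_vertices 1 1 s s) (\<lambda>z. poly P (fst z)) z"
  let ?I = "\<lambda>i. LINT z:?\<Omega>|lebesgue. \<bar>weak_deriv (i, 1 - i) ?\<Omega> ?e z\<bar> powr p"
  have c: "continuous_on ?\<Omega> (\<lambda>z. - (dY_numer P t (F_inverse t z) / jac t z))"
    using continuous_on_K_quotient interior_subset by (rule continuous_on_subset)
  have w: "weak_deriv (0, 1) ?\<Omega> ?e =
      weak_deriv (0, 1) ?\<Omega> (\<lambda>z. poly P (fst z) - interpolant P t (F_inverse t z))"
    using interior_subset[of "K_polygon s"] by (intro weak_deriv_cong) (auto simp: Q_interp_K subset_iff)
  have "?I 0 = (LINT z:?\<Omega>|lborel. \<bar>- (dY_numer P t (F_inverse t z) / jac t z)\<bar> powr p)"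
    unfolding diff_zero w using p
    by (intro weak_deriv_Lp_integral[OF open_interior is_weak_deriv_error_y c]) simp
  then have 0: "?I 0 = (LINT z:?\<Omega>|lborel. \<bar>dY_numer P t (F_inverse t z) / jac t z\<bar> powr p)"
    by (simp only: abs_minus_cancel)
  have nn: "0 \<le> ?I i" for i
    unfolding set_lebesgue_integral_def by (rule Bochner_Integration.integral_nonneg) simp
  have "?I 0 \<le> (\<Sum>i\<le>1. ?I i)"
    by (rule member_le_sum[OF _ nn]) simp_all
  then have "?I 0 powr (1 / p) \<le> (\<Sum>i\<le>1. ?I i) powr (1 / p)"
    by (intro powr_mono2 nn) (use p in simp_all)
  then show ?thesis
    unfolding 0 sobolev_seminorm_def quad_K[OF s t] .
qed

section \<open>Logarithmic blow-up near the flat vertex\<close>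

text \<open>With \<open>(X, Y) = (s - a, s - b)\<close> the radicand of \<open>jac\<close> is
\<open>(2 s - 1)\<^sup>2 + 2 t (a + b) + t\<^sup>2 (a - b)\<^sup>2\<close>. Keeping \<open>a + b\<close> of order \<open>a\<^sup>2\<close> makes it of order \<open>a\<^sup>2\<close> as long as
\<open>a\<close> is at least \<open>2 s - 1\<close>. The factor 8 keeps the region inside the element: the edge
to \<open>(0, 1)\<close> requires \<open>t (a + b) + (2 s - 1) b > 0\<close>, where the last term is at least
\<open>- (2 s - 1) a \<ge> - a\<^sup>2\<close> and \<open>t \<ge> 3/8\<close>.\<close>

lemma region_near_vertex:
  assumes a: "2 * s - 1 \<le> a" "0 < a" "a \<le> 1 / 64" and b: "8 * a\<^sup>2 < a + b" "a + b < 9 * a\<^sup>2"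
  shows "(s - a, s - b) \<in> interior (K_polygon s)"
    and "jac t (s - a, s - b) \<le> 4 * a"
proof -
  have t0: "3 / 8 \<le> t" "t < 1 / 2" "2 * s - 1 = s - t" "2 * s - 1 = 1 - 2 * t" using s t by auto
  have a2: "9 * a\<^sup>2 \<le> a" using a by (simp add: power2_eq_square)
  have pos: "0 < a\<^sup>2" using a by simp
  show "(s - a, s - b) \<in> interior (K_polygon s)"
  proof (rule interior_K[OF s t])
    show "0 < s - a" "0 < s - b" using s a b a2 by auto
    have "0 < t * (a + b)" using t0 b pos by (intro mult_pos_pos) auto
    moreover have "0 \<le> (s - t) * a" using t0 s a by (intro mult_nonneg_nonneg) auto
    ultimately have "0 < t * (a + b) + (s - t) * a" by linarith
    then show "s * (s - a) + (1 - s) * (s - b) < s" by (simp add: t algebra_simps)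
    have "t * (8 * a\<^sup>2) \<le> t * (a + b)" using t0 b by (intro mult_left_mono) auto
    moreover have "3 / 8 * (8 * a\<^sup>2) \<le> t * (8 * a\<^sup>2)" using t0 by (intro mult_right_mono) auto
    moreover have "(s - t) * (- b) \<le> (s - t) * a" using t0 s b pos by (intro mult_left_mono) auto
    moreover have "(s - t) * a \<le> a * a" using t0 a by (intro mult_right_mono) auto
    ultimately have "0 < t * (a + b) + (s - t) * b"
      using pos by (simp add: power2_eq_square)
    then show "(1 - s) * (s - a) + s * (s - b) < s" by (simp add: t algebra_simps)
  qed
  have "1 - 2 * t * ((s - a) + (s - b)) + t\<^sup>2 * ((s - a) - (s - b))\<^sup>2 =
      (2 * s - 1)\<^sup>2 + 2 * t * (a + b) + t\<^sup>2 * (2 * a - (a + b))\<^sup>2"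
    unfolding t by (simp add: power2_eq_square algebra_simps)
  also have "\<dots> \<le> a\<^sup>2 + 1 * (9 * a\<^sup>2) + (1/2)\<^sup>2 * (2 * a)\<^sup>2"
  proof (intro add_mono mult_mono)
    show "(2 * s - 1)\<^sup>2 \<le> a\<^sup>2" using s a by (intro power_mono) auto
    show "t\<^sup>2 \<le> (1/2)\<^sup>2" using t0 by (intro power_mono) auto
    show "(2 * a - (a + b))\<^sup>2 \<le> (2 * a)\<^sup>2" using a b a2 pos by (intro power_mono) auto
  qed (use t0 b pos in auto)
  also have "\<dots> \<le> (4 * a)\<^sup>2" by (simp add: power2_eq_square)
  finally show "jac t (s - a, s - b) \<le> 4 * a"
    unfolding jac_def prod.case using a by (intro real_le_lsqrt) auto
qed

lemma F_inverse_near_corner: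
  assumes z: "z \<in> K_polygon s"
  shows "1 - 3 * jac t z \<le> fst (F_inverse t z)" "1 - 3 * jac t z \<le> snd (F_inverse t z)"
proof -
  have t0: "3 / 8 \<le> t" "t < 1 / 2" using s t by auto
  obtain X Y where XY: "z = (X, Y)" by (cases z)
  have sq: "fst (F_inverse t z) \<le> 1" "snd (F_inverse t z) \<le> 1"
    using F_inverse_in_square[OF s t z] by (auto simp: ref_square_def)
  have "t * (fst (F_inverse t z) + snd (F_inverse t z)) = 1 - jac t z"
    using t0 by (simp add: F_inverse_def XY field_simps)
  then have "t * (2 - (fst (F_inverse t z) + snd (F_inverse t z))) \<le> jac t z"
    using t0 by (simp add: algebra_simps)
  moreover have "3 / 8 * (2 - (fst (F_inverse t z) + snd (F_inverse t z))) \<le>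
      t * (2 - (fst (F_inverse t z) + snd (F_inverse t z)))"
    using t0 sq by (intro mult_right_mono) auto
  ultimately have "3 / 8 * (2 - (fst (F_inverse t z) + snd (F_inverse t z))) \<le> jac t z"
    by (rule order_trans[rotated])
  then show "1 - 3 * jac t z \<le> fst (F_inverse t z)" "1 - 3 * jac t z \<le> snd (F_inverse t z)"
    using sq jac_pos[OF s t z] by (simp_all add: field_simps)
qed

end

text \<open>The slice of \<open>R\<close> at \<open>a = s - X\<close> is an interval of length \<open>a\<^sup>2\<close>, so the cubic singularity integrates
to \<open>1 / a\<close> over the slice and to a logarithm over \<open>R\<close>.\<close>

lemma nn_integral_horn:
  fixes s \<epsilon> \<delta> :: real
  assumes "0 < \<epsilon>" "\<epsilon> \<le> \<delta>"
  defines "R \<equiv> {(X, Y). \<epsilon> \<le> s - X \<and> s - X \<le> \<delta> \<and> 8 * (s - X)\<^sup>2 < (s - X) + (s - Y) \<and> (s - X) + (s - Y) < 9 * (s - X)\<^sup>2}"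
  shows "(\<integral>\<^sup>+z. ennreal (1 / (s - fst z) ^ 3) * indicator R z \<partial>lborel) = ennreal (ln (\<delta> / \<epsilon>))"
proof -
  have "(\<lambda>z. ennreal (1 / (s - fst z) ^ 3) * indicator R z) \<in> borel_measurable (lborel \<Otimes>\<^sub>M lborel)"
    unfolding R_def indicator_def case_prod_beta by measurable
  then have "(\<integral>\<^sup>+z. ennreal (1 / (s - fst z) ^ 3) * indicator R z \<partial>lborel) =
      (\<integral>\<^sup>+X. \<integral>\<^sup>+Y. ennreal (1 / (s - X) ^ 3) * indicator R (X, Y) \<partial>lborel \<partial>lborel)"
    by (simp add: lborel.nn_integral_fst[symmetric] lborel_prod[symmetric])
  also have "\<dots> = (\<integral>\<^sup>+X. ennreal (1 / (s - X)) * indicator {s - \<delta>..s - \<epsilon>} X \<partial>lborel)"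
  proof (rule nn_integral_cong)
    fix X :: real
    show "(\<integral>\<^sup>+Y. ennreal (1 / (s - X) ^ 3) * indicator R (X, Y) \<partial>lborel) =
        ennreal (1 / (s - X)) * indicator {s - \<delta>..s - \<epsilon>} X"
    proof (cases "X \<in> {s - \<delta>..s - \<epsilon>}")
      case True
      define a where "a = s - X"
      have a: "0 < a" using True assms by (auto simp: a_def)
      have "indicator R (X, Y) = (indicator {s + a - 9 * a\<^sup>2<..<s + a - 8 * a\<^sup>2} Y :: ennreal)" for Y
        using True by (auto simp: R_def a_def indicator_def)
      then have "(\<integral>\<^sup>+Y. ennreal (1 / (s - X) ^ 3) * indicator R (X, Y) \<partial>lborel) =
          ennreal (1 / a ^ 3) * ennreal (a\<^sup>2)"
        by (simp add: a_def[symmetric] nn_integral_cmult_indicator)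
      also have "\<dots> = ennreal (1 / a)"
        using a by (simp add: ennreal_mult'[symmetric] power2_eq_square power3_eq_cube)
      finally show ?thesis using True by (simp add: a_def)
    next
      case False
      then have "indicator R (X, Y) = (0::ennreal)" for Y by (auto simp: R_def)
      then show ?thesis using False by simp
    qed
  qed
  also have "\<dots> = ennreal (- ln (s - (s - \<epsilon>)) - (- ln (s - (s - \<delta>))))"
  proof (rule nn_integral_FTC_Icc[where F = "\<lambda>X. - ln (s - X)"])
    show "((\<lambda>X. - ln (s - X)) has_real_derivative 1 / (s - X)) (at X)"
      if "X \<in> {s - \<delta>..s - \<epsilon>}" for X
      using that assms by (auto intro!: derivative_eq_intros)
    show "0 \<le> 1 / (s - X)" if "X \<in> {s - \<delta>..s - \<epsilon>}" for X
      using that assms by simp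
  qed (use assms in auto)
  also have "- ln (s - (s - \<epsilon>)) - (- ln (s - (s - \<delta>))) = ln (\<delta> / \<epsilon>)"
    using assms by (simp add: ln_div)
  finally show ?thesis .
qed

text \<open>Here the exponent 3 is critical: the integrand is at least a multiple of \<open>jac\<close> to the power \<open>- p\<close>,
hence of \<open>a\<close> to the power \<open>- 3\<close>, on a region whose slices have length \<open>a\<^sup>2\<close>.\<close>

lemma error_integral_ge:
  assumes p: "3 \<le> p" and \<eta>: "0 < \<eta>" and c: "0 < c"
    and dY_numer: "\<And>t x y. \<bar>t - 1/2\<bar> < \<eta> \<Longrightarrow> 1 - \<eta> < x \<Longrightarrow> x \<le> 1 \<Longrightarrow> 1 - \<eta> < y \<Longrightarrow> y \<le> 1 \<Longrightarrow> c \<le> dY_numer P t (x, y)"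
    and \<delta>: "\<delta> \<le> 1 / 64" "12 * \<delta> < \<eta>"
    and s: "1 / 2 < s" "2 * s - 1 \<le> \<delta>" and t: "t = 1 - s"
  shows "(c / 4) powr p * ln (\<delta> / (2 * s - 1)) \<le>
    (LINT z:interior (K_polygon s)|lborel. \<bar>dY_numer P t (F_inverse t z) / jac t z\<bar> powr p)"
proof -
  let ?\<Omega> = "interior (K_polygon s)" and ?g = "\<lambda>z. \<bar>dY_numer P t (F_inverse t z) / jac t z\<bar> powr p"
  let ?R = "{(X, Y). 2 * s - 1 \<le> s - X \<and> s - X \<le> \<delta> \<and> 8 * (s - X)\<^sup>2 < (s - X) + (s - Y) \<and> (s - X) + (s - Y) < 9 * (s - X)\<^sup>2}"
  have s': "s \<le> 5 / 8" using s \<delta> by simp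
  note st = s(1) s' t
  have "compact (K_polygon s)"
    unfolding quad_K[OF st, symmetric] quad_def by (intro finite_imp_compact_convex_hull) simp
  moreover have "continuous_on (K_polygon s) ?g"
  proof -
    have "continuous_on (K_polygon s) (\<lambda>z. \<bar>- (dY_numer P t (F_inverse t z) / jac t z)\<bar> powr p)"
      by (rule continuous_on_powr'[OF continuous_on_rabs[OF continuous_on_K_quotient[OF st]] continuous_on_const])
        (use p in simp)
    then show ?thesis by (simp only: abs_minus_cancel)
  qed
  ultimately have "set_integrable lborel (K_polygon s) ?g"
    unfolding set_integrable_def by (rule borel_integrable_compact)
  then have "set_integrable lborel ?\<Omega> ?g"
    by (rule set_integrable_subset) (auto simp: interior_subset)
  then have int: "integrable lborel (\<lambda>z. indicator ?\<Omega> z *\<^sub>R ?g z)"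
    by (simp add: set_integrable_def)
  have pointwise: "ennreal ((c / 4) powr p) * (ennreal (1 / (s - fst z) ^ 3) * indicator ?R z) \<le>
      ennreal (indicator ?\<Omega> z *\<^sub>R ?g z)" for z
  proof (cases "z \<in> ?R")
    case True
    obtain X Y where XY: "z = (X, Y)" by (cases z)
    define a where "a = s - X"
    define b where "b = s - Y"
    have z: "z = (s - a, s - b)" by (simp add: XY a_def b_def)
    have ab: "2 * s - 1 \<le> a" "a \<le> \<delta>" "8 * a\<^sup>2 < a + b" "a + b < 9 * a\<^sup>2"
      using True by (auto simp: XY a_def b_def)
    have a: "0 < a" "a \<le> 1 / 64" using ab s \<delta> by auto
    have in\<Omega>: "z \<in> ?\<Omega>" and j: "jac t z \<le> 4 * a"
      unfolding z using region_near_vertex[OF st ab(1) a ab(3,4)] by auto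
    then have zK: "z \<in> K_polygon s" using interior_subset by blast
    have jp: "0 < jac t z" using zK by (rule jac_pos[OF st])
    obtain x y where xy: "F_inverse t z = (x, y)" by (cases "F_inverse t z")
    have "c \<le> dY_numer P t (x, y)"
    proof (rule dY_numer)
      show "\<bar>t - 1/2\<bar> < \<eta>" using s \<delta> ab t a by (auto simp: abs_if)
      show "1 - \<eta> < x" "1 - \<eta> < y"
        using F_inverse_near_corner[OF st zK] j ab(2) \<delta> by (auto simp: xy)
      show "x \<le> 1" "y \<le> 1"
        using F_inverse_in_square[OF st zK] by (auto simp: xy ref_square_def)
    qed
    then have n: "c \<le> dY_numer P t (F_inverse t z)" by (simp add: xy)
    have "c / (4 * a) \<le> dY_numer P t (F_inverse t z) / jac t z"
      using c n j jp by (intro frac_le) auto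
    then have "c / (4 * a) \<le> \<bar>dY_numer P t (F_inverse t z) / jac t z\<bar>" by linarith
    then have "(c / (4 * a)) powr p \<le> ?g z"
      by (rule powr_mono2[rotated 2]) (use c a p in simp_all)
    moreover have "(c / (4 * a)) powr p = (c / 4) powr p * (1 / a) powr p"
      using c a by (simp add: powr_mult[symmetric])
    moreover have "1 / a ^ 3 \<le> (1 / a) powr p"
    proof -
      have "1 / a ^ 3 = (1 / a) powr 3"
        using a by (simp add: power_one_over powr_numeral)
      also have "\<dots> \<le> (1 / a) powr p"
        using a p by (intro powr_mono) auto
      finally show ?thesis .
    qed
    ultimately have "(c / 4) powr p * (1 / a ^ 3) \<le> ?g z"
      using mult_left_mono[of "1 / a ^ 3" "(1 / a) powr p" "(c / 4) powr p"] by simp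
    then show ?thesis
      using True in\<Omega> a by (simp add: XY a_def[symmetric] ennreal_mult'[symmetric] ennreal_leI)
  next
    case False
    then have "indicator ?R z = (0::ennreal)" by (rule indicator_simps(2))
    then show ?thesis by (simp only: mult_zero_right zero_le)
  qed
  have meas: "(\<lambda>z. ennreal (1 / (s - fst z) ^ 3) * indicator ?R z) \<in> borel_measurable lborel"
    unfolding lborel_prod[symmetric] indicator_def case_prod_beta by measurable
  have "ennreal ((c / 4) powr p * ln (\<delta> / (2 * s - 1))) =
      ennreal ((c / 4) powr p) * (\<integral>\<^sup>+z. ennreal (1 / (s - fst z) ^ 3) * indicator ?R z \<partial>lborel)"
    using s by (subst nn_integral_horn) (auto simp: ennreal_mult')
  also have "\<dots> = (\<integral>\<^sup>+z. ennreal ((c / 4) powr p) * (ennreal (1 / (s - fst z) ^ 3) * indicator ?R z) \<partial>lborel)"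
    by (rule nn_integral_cmult[OF meas, symmetric])
  also have "\<dots> \<le> (\<integral>\<^sup>+z. ennreal (indicator ?\<Omega> z *\<^sub>R ?g z) \<partial>lborel)"
    by (rule nn_integral_mono) (rule pointwise)
  also have "\<dots> = ennreal (LINT z:?\<Omega>|lborel. ?g z)"
    unfolding set_lebesgue_integral_def by (rule nn_integral_eq_integral[OF int]) simp
  finally show ?thesis
    by (subst (asm) ennreal_le_iff) (auto simp: set_lebesgue_integral_def)
qed

section \<open>Failure of the interpolation estimate\<close>

definition u_poly :: "real poly" where
  "u_poly = [:0, 1:] * [:- (1/4), 1:] * [:- (3/4), 1:] * [:- (3/8), 1:] * [:- 1, 1:]"

text \<open>For \<open>t = 1/2\<close> the nodes have first coordinates 0, 1/4, 3/8, 1/2, 3/4 and 1. All of them except 1/2 are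
roots of \<open>u\<close>, and 1/2 is attained exactly at the corner \<open>(1, 1)\<close> and at the edge midpoint \<open>(1/2, 0)\<close>.
Only the corner contributes at \<open>(1, 1)\<close>: the value \<open>u(1/2) = 1/512\<close> times \<open>1/2 (3 + 3)\<close>.\<close>

lemma dY_numer_u_poly: "dY_numer u_poly (1/2) (1, 1) = 3 / 512"
  by (simp add: dY_numer_def sum_atMost_2 node_value_def lagr_def lagr'_def u_poly_def)

lemma dY_numer_u_poly_near:
  obtains \<eta> where "0 < \<eta>"
    "\<And>t x y. \<bar>t - 1/2\<bar> < \<eta> \<Longrightarrow> 1 - \<eta> < x \<Longrightarrow> x \<le> 1 \<Longrightarrow> 1 - \<eta> < y \<Longrightarrow> y \<le> 1 \<Longrightarrow>
      1 / 512 \<le> dY_numer u_poly t (x, y)"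
proof -
  let ?f = "\<lambda>w::real\<times>real\<times>real. dY_numer u_poly (fst w) (fst (snd w), snd (snd w))"
  have "continuous_on UNIV ?f"
    by (intro continuous_on_dY_numer continuous_intros)
  then obtain d where d: "d > 0" "\<And>w. dist w (1/2, 1, 1) < d \<Longrightarrow> dist (?f w) (?f (1/2, 1, 1)) < 2 / 512"
    unfolding continuous_on_iff by (metis UNIV_I zero_less_divide_iff zero_less_numeral)
  show ?thesis
  proof (rule that[of "d / 3"])
    fix t x y :: real
    assume h: "\<bar>t - 1/2\<bar> < d / 3" "1 - d / 3 < x" "x \<le> 1" "1 - d / 3 < y" "y \<le> 1"
    have "dist (t, x, y) (1/2, 1, 1) \<le> \<bar>t - 1/2\<bar> + norm (x - 1, y - 1)"
      using norm_Pair_le[of "t - 1/2" "(x - 1, y - 1)"] by (simp add: dist_norm)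
    also have "norm (x - 1, y - 1) \<le> \<bar>x - 1\<bar> + \<bar>y - 1\<bar>"
      using norm_Pair_le[of "x - 1" "y - 1"] by simp
    finally have "dist (t, x, y) (1/2, 1, 1) < d" using h by simp
    then have "\<bar>dY_numer u_poly t (x, y) - 3 / 512\<bar> < 2 / 512"
      using d(2)[of "(t, x, y)"] dY_numer_u_poly by (simp add: dist_real_def)
    then show "1 / 512 \<le> dY_numer u_poly t (x, y)" by linarith
  qed (use d in simp)
qed

theorem mainTheorem3:
  fixes p :: real and V :: "real \<Rightarrow> nat \<Rightarrow> real \<times> real" and u :: "real \<times> real \<Rightarrow> real"
  assumes p: "3 \<le> p"
    and V: "\<And>s. V s = K_vertices 1 1 s s"
    and u: "\<And>x y. u (x, y) = x * (x - 1/4) * (x - 3/4) * (x - 3/8) * (x - 1)"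
  shows "(\<forall>s\<in>{1/2<..5/8}. mac (pi / 4) (V s))
    \<and> ((\<lambda>s. max_angle (V s)) \<longlongrightarrow> pi) (at_right (1/2))
    \<and> \<not> (\<exists>C::real. \<forall>s\<in>{1/2<..5/8}.
          sobolev_seminorm 1 p (quad (V s)) (\<lambda>X. u X - Q_interp 2 (V s) u X)
            \<le> C * diameter (quad (V s)) ^ 2 * sobolev_seminorm 3 p (quad (V s)) u)"
proof (intro conjI ballI notI)
  show "mac (pi / 4) (V s)" if "s \<in> {1/2<..5/8}" for s
    using that mac_K by (simp add: V)
  show "((\<lambda>s. max_angle (V s)) \<longlongrightarrow> pi) (at_right (1/2))"
    unfolding V by (rule max_angle_K_tendsto)
  have u_eq: "u = (\<lambda>z. poly u_poly (fst z))"
  proof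
    fix z :: "real \<times> real"
    have linear: "poly [:0, 1:] x = x" "poly [:- c, 1:] x = x - c" for x c :: real by simp_all
    show "u z = poly u_poly (fst z)"
      by (cases z) (simp only: u u_poly_def poly_mult linear fst_conv)
  qed
  assume "\<exists>C::real. \<forall>s\<in>{1/2<..5/8}.
      sobolev_seminorm 1 p (quad (V s)) (\<lambda>X. u X - Q_interp 2 (V s) u X)
        \<le> C * diameter (quad (V s)) ^ 2 * sobolev_seminorm 3 p (quad (V s)) u"
  then obtain C where C: "\<forall>s\<in>{1/2<..5/8}.
      sobolev_seminorm 1 p (quad (V s)) (\<lambda>X. u X - Q_interp 2 (V s) u X)
        \<le> C * diameter (quad (V s)) ^ 2 * sobolev_seminorm 3 p (quad (V s)) u"
    by blast
  obtain M where M: "0 \<le> M" "\<And>x. 0 \<le> x \<Longrightarrow> x \<le> 1 \<Longrightarrow> \<bar>poly ((pderiv ^^ 3) u_poly) x\<bar> \<le> M"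
  proof -
    have "bounded (poly ((pderiv ^^ 3) u_poly) ` {0..1})"
      by (intro compact_imp_bounded compact_continuous_image continuous_intros) simp
    then obtain M where "\<forall>x\<in>{0..1}. \<bar>poly ((pderiv ^^ 3) u_poly) x\<bar> \<le> M"
      unfolding bounded_iff by auto
    then show ?thesis by (intro that[of M]) force+
  qed
  let ?Q = "cbox (0, 0) (1, 1) :: (real \<times> real) set"
  define A where "A = \<bar>C\<bar> * diameter ?Q ^ 2 * M"
  have A0: "0 \<le> A" using M by (simp add: A_def)
  have upper: "sobolev_seminorm 1 p (quad (V s)) (\<lambda>X. u X - Q_interp 2 (V s) u X) \<le> A"
    if s: "1/2 < s" "s \<le> 5/8" for s
  proof -
    have sub: "quad (V s) \<subseteq> ?Q"
      using K_polygon_bounds(1,2)[OF s refl]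
      by (auto simp: V quad_K[OF s refl] K_polygon_def mem_box Basis_prod_def)
    have "sobolev_seminorm 3 p (quad (V s)) u \<le> M"
      unfolding u_eq using p sub interior_subset M by (intro sobolev_seminorm_poly_fst_le) auto
    moreover have "diameter (quad (V s)) ^ 2 \<le> diameter ?Q ^ 2"
      using sub by (intro power_mono diameter_subset diameter_ge_0 bounded_subset[OF _ sub]) auto
    moreover have "0 \<le> sobolev_seminorm 3 p (quad (V s)) u"
      by (simp add: sobolev_seminorm_def)
    ultimately have "C * diameter (quad (V s)) ^ 2 * sobolev_seminorm 3 p (quad (V s)) u \<le> A"
      unfolding A_def by (intro mult_mono) auto
    moreover have "s \<in> {1/2<..5/8}" using s by simp
    ultimately show ?thesis using C by (blast intro: order_trans)
  qed
  obtain \<eta> where \<eta>: "0 < \<eta>" and dY_numer: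
    "\<And>t x y. \<bar>t - 1/2\<bar> < \<eta> \<Longrightarrow> 1 - \<eta> < x \<Longrightarrow> x \<le> 1 \<Longrightarrow> 1 - \<eta> < y \<Longrightarrow> y \<le> 1 \<Longrightarrow>
      1 / 512 \<le> dY_numer u_poly t (x, y)"
    by (rule dY_numer_u_poly_near) blast
  define \<kappa> :: real where "\<kappa> = (1 / 512 / 4) powr p"
  have \<kappa>: "0 < \<kappa>" by (simp add: \<kappa>_def)
  define \<delta> where "\<delta> = min (1 / 64) (\<eta> / 13)"
  have \<delta>: "0 < \<delta>" "\<delta> \<le> 1 / 64" "12 * \<delta> < \<eta>" using \<eta> by (auto simp: \<delta>_def min_def)
  \<comment> \<open>This makes \<open>\<kappa> * ln (\<delta> / \<epsilon>)\<close> equal to \<open>A powr p + \<kappa>\<close>, which exceeds the bound \<open>A powr p\<close>.\<close>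
  define \<epsilon> where "\<epsilon> = \<delta> * exp (- (A powr p / \<kappa> + 1))"
  have \<epsilon>: "0 < \<epsilon>" using \<delta> by (simp add: \<epsilon>_def)
  have "0 \<le> A powr p / \<kappa> + 1" using \<kappa> by (intro add_nonneg_nonneg divide_nonneg_pos) auto
  then have "\<epsilon> \<le> \<delta>" using \<delta> by (simp add: \<epsilon>_def)
  have ln: "ln (\<delta> / \<epsilon>) = A powr p / \<kappa> + 1"
    using \<delta> by (simp add: \<epsilon>_def ln_div ln_mult)
  define s where "s = (1 + \<epsilon>) / 2"
  have s: "1/2 < s" "s \<le> 5/8" "2 * s - 1 = \<epsilon>"
    using \<epsilon> \<open>\<epsilon> \<le> \<delta>\<close> \<delta> by (simp_all add: s_def field_simps)
  let ?L = "LINT z:interior (K_polygon s)|lborel. \<bar>dY_numer u_poly (1 - s) (F_inverse (1 - s) z) / jac (1 - s) z\<bar> powr p"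
  have "\<kappa> * ln (\<delta> / (2 * s - 1)) \<le> ?L"
    unfolding \<kappa>_def
    by (rule error_integral_ge[OF p \<eta> _ dY_numer \<delta>(2,3) s(1) _ refl]) (use s \<open>\<epsilon> \<le> \<delta>\<close> in auto)
  moreover have "\<kappa> * ln (\<delta> / (2 * s - 1)) = A powr p + \<kappa>"
    unfolding s(3) ln using \<kappa> by (simp add: field_simps)
  ultimately have "A powr p < ?L" using \<kappa> by linarith
  then have "(A powr p) powr (1 / p) < ?L powr (1 / p)"
    using p by (intro powr_less_mono2) auto
  also have "\<dots> \<le> sobolev_seminorm 1 p (quad (V s)) (\<lambda>X. u X - Q_interp 2 (V s) u X)"
    unfolding V u_eq using p by (intro seminorm_error_ge[OF s(1,2) refl]) simp
  also have "\<dots> \<le> A" by (rule upper[OF s(1,2)])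
  finally show False using A0 p by (simp add: powr_powr)
qed

end
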